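(* Let $p,q\ge 1$ and $m\ge 1$ be integers, let $n=p+q$, and let $B,C$ be the commuting operators on $C^\infty(S^p\times S^q)$ defined by $$C=\sqrt{\Delta_{S^q}+\left(\tfrac{q-1}{2}\right)^2},\qquad B=\sqrt{\Delta_{S^p}+\left(\tfrac{p-1}{2}\right)^2}.$$ Let $u,v$ be numbers with $u+v=m-\tfrac n2$, and put $Q=\tfrac{q-1}{2}+v$ and $P=\tfrac{p-1}{2}+u$, so that $P+Q=m-1$. Define $$A_{2m}(C,B,Q)=\sum_{\ell=0}^{m}(-1)^{m-\ell}\binom{m}{\ell}\left[\prod_{i=0}^{\ell-1}(C+Q-2i)(C-Q+2i)\right]\left[\prod_{i=0}^{m-\ell-1}(B+P-2i)(B-P+2i)\right],$$ where empty products equal $1$. Then $$A_{2m}(C,B,Q)=\prod_{i=0}^{m-1}(C+B+m-1-2i)\;\prod_{i=0}^{m-1}(C-B+m-1-2i).$$ In particular $A_{2m}(C,B,Q)$ does not depend on $Q$.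
   Context: $S^p$ and $S^q$ are the unit round spheres. $\Delta_{S^p}$ and $\Delta_{S^q}$ are their Laplacians with the sign convention $\Delta=-g^{ab}\nabla_a\nabla_b$ (nonnegative operators), each acting on functions on $S^p\times S^q$ through the corresponding factor. The eigenvalues of $\Delta_{S^q}$ are $j(q-1+j)$, $j=0,1,2,\dots$. The square roots denote the nonnegative operators defined spectrally: $C$ acts as $j+\tfrac{q-1}{2}$ on degree-$j$ spherical harmonics of $S^q$, and $B$ acts as $k+\tfrac{p-1}{2}$ on degree-$k$ spherical harmonics of $S^p$. Numbers appearing in sums with $B$ or $C$ stand for the corresponding multiples of the identity operator. *)

theory Defs
  imports "HOL-Analysis.Analysis" "HOL-Library.Function_Algebras"
begin

text \<open>Intended for open sets of finite-dimensional spaces.\<close>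

primrec Ck_on ::
  "nat \<Rightarrow> 'e::euclidean_space set \<Rightarrow> ('e \<Rightarrow> complex) \<Rightarrow> bool" where
  "Ck_on 0 U F \<longleftrightarrow> continuous_on U F"
| "Ck_on (Suc k) U F \<longleftrightarrow> (\<forall>x\<in>U. F differentiable (at x)) \<and>
     (\<forall>w. Ck_on k U (\<lambda>x. frechet_derivative F (at x) w))"

definition smooth_on :: "'e::euclidean_space set \<Rightarrow> ('e \<Rightarrow> complex) \<Rightarrow> bool" where
  "smooth_on U F \<longleftrightarrow> (\<forall>k. Ck_on k U F)"

definition sphere_prod :: "('a::euclidean_space \<times> 'b::euclidean_space) set" where
  "sphere_prod = sphere 0 1 \<times> sphere 0 1"

text \<open>
  A function on the product of the spheres is represented by a function on the ambient space
  that vanishes off the spheres, so that equality of such functions is plain equality.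
  Smoothness on this compact embedded submanifold means that there is a smooth extension to
  a neighbourhood.
\<close>

definition smooth_fns :: "('a::euclidean_space \<times> 'b::euclidean_space \<Rightarrow> complex) set" where
  "smooth_fns = {f. (\<forall>z. z \<notin> sphere_prod \<longrightarrow> f z = 0) \<and>
     (\<exists>U F. open U \<and> sphere_prod \<subseteq> U \<and> smooth_on U F \<and> (\<forall>z\<in>sphere_prod. f z = F z))}"

definition euclidean_laplacian ::
  "('e::euclidean_space \<Rightarrow> complex) \<Rightarrow> 'e \<Rightarrow> complex" where
  "euclidean_laplacian F x =
     (\<Sum>b\<in>Basis. frechet_derivative (\<lambda>y. frechet_derivative F (at y) b) (at x) b)"

text \<open>
  The Laplacian \<open>- g\<^sup>a\<^sup>b \<nabla>\<^sub>a \<nabla>\<^sub>b\<close> of the round unit sphere. The Levi-Civita connection of the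
  sphere is the tangential part of the Euclidean one, and for the extension of a function that
  is constant along rays the radial contributions to the Euclidean Laplacian vanish at points
  of the sphere. So the trace of the covariant Hessian is the Euclidean Laplacian of that
  extension.
\<close>

definition sphere_laplacian ::
  "('e::euclidean_space \<Rightarrow> complex) \<Rightarrow> 'e \<Rightarrow> complex" where
  "sphere_laplacian h x = - euclidean_laplacian (\<lambda>y. h (y /\<^sub>R norm y)) x"

definition laplacian_fst ::
  "('a::euclidean_space \<times> 'b::euclidean_space \<Rightarrow> complex) \<Rightarrow> 'a \<times> 'b \<Rightarrow> complex" where
  "laplacian_fst f =
     (\<lambda>(x, y). if (x, y) \<in> sphere_prod then sphere_laplacian (\<lambda>x'. f (x', y)) x else 0)"

definition laplacian_snd ::
  "('a::euclidean_space \<times> 'b::euclidean_space \<Rightarrow> complex) \<Rightarrow> 'a \<times> 'b \<Rightarrow> complex" where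
  "laplacian_snd f =
     (\<lambda>(x, y). if (x, y) \<in> sphere_prod then sphere_laplacian (\<lambda>y'. f (x, y')) y else 0)"

text \<open>Only the values of \<open>Y\<close> on the unit sphere matter.\<close>

definition spherical_harmonic ::
  "nat \<Rightarrow> ('e::euclidean_space \<Rightarrow> complex) \<Rightarrow> bool" where
  "spherical_harmonic j Y \<longleftrightarrow>
     (\<exists>H. polynomial_function H \<and> (\<forall>c x. H (c *\<^sub>R x) = c ^ j *\<^sub>R H x) \<and>
          (\<forall>x. euclidean_laplacian H x = 0) \<and> (\<forall>x\<in>sphere 0 1. Y x = H x))"

text \<open>
  The Riemannian volume of a Borel subset of the unit sphere of a Euclidean space of
  dimension \<open>d\<close> is \<open>d\<close> times the Lebesgue measure of the cone over it in the unit ball.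
\<close>

definition sphere_measure :: "'e::euclidean_space measure" where
  "sphere_measure = scale_measure (of_nat DIM('e))
     (distr (restrict_space lborel (ball 0 1)) borel (\<lambda>x. x /\<^sub>R norm x))"

definition l2_inner :: "('a::euclidean_space \<times> 'b::euclidean_space \<Rightarrow> complex) \<Rightarrow>
    ('a \<times> 'b \<Rightarrow> complex) \<Rightarrow> complex" where
  "l2_inner f g = (\<integral>z. f z * cnj (g z) \<partial>(sphere_measure \<Otimes>\<^sub>M sphere_measure))"

text \<open>
  Sums and differences of operators are the pointwise ones of \<^theory>\<open>HOL-Library.Function_Algebras\<close>,
  and products are compositions, not the pointwise products of that theory.
\<close>

type_synonym ('a, 'b) operator = "('a \<times> 'b \<Rightarrow> complex) \<Rightarrow> ('a \<times> 'b \<Rightarrow> complex)"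

definition scalar_op :: "complex \<Rightarrow> ('a, 'b) operator" where
  "scalar_op c f = (\<lambda>z. c * f z)"

text \<open>\<open>op_prod T n\<close> is \<open>T 0 \<circ> T 1 \<circ> \<dots> \<circ> T (n - 1)\<close>.\<close>

definition op_prod :: "(nat \<Rightarrow> ('a, 'b) operator) \<Rightarrow> nat \<Rightarrow> ('a, 'b) operator" where
  "op_prod T n = foldr (\<circ>) (map T [0..<n]) id"

text \<open>
  The pre-Hilbert space is the space of smooth functions; nothing is said about \<open>T\<close> and \<open>R\<close>
  outside it.
\<close>

definition nonneg_sqrt ::
  "('a::euclidean_space, 'b::euclidean_space) operator \<Rightarrow> ('a, 'b) operator \<Rightarrow> bool" where
  "nonneg_sqrt T R \<longleftrightarrow>
     (\<forall>f\<in>smooth_fns. R f \<in> smooth_fns) \<and>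
     (\<forall>f\<in>smooth_fns. \<forall>g\<in>smooth_fns. \<forall>a b.
        R (scalar_op a f + scalar_op b g) = scalar_op a (R f) + scalar_op b (R g)) \<and>
     (\<forall>f\<in>smooth_fns. \<forall>g\<in>smooth_fns. l2_inner (R f) g = l2_inner f (R g)) \<and>
     (\<forall>f\<in>smooth_fns. 0 \<le> Re (l2_inner (R f) f)) \<and>
     (\<forall>f\<in>smooth_fns. R (R f) = T f)"

definition A_op :: "nat \<Rightarrow> ('a, 'b) operator \<Rightarrow> ('a, 'b) operator \<Rightarrow>
    complex \<Rightarrow> complex \<Rightarrow> ('a, 'b) operator" where
  "A_op m C B P Q = (\<Sum>l = 0..m.
     scalar_op ((-1) ^ (m - l) * of_nat (m choose l)) \<circ>
     op_prod (\<lambda>i. (C + scalar_op (Q - 2 * of_nat i)) \<circ> (C + scalar_op (- Q + 2 * of_nat i))) l \<circ>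
     op_prod (\<lambda>i. (B + scalar_op (P - 2 * of_nat i)) \<circ> (B + scalar_op (- P + 2 * of_nat i))) (m - l))"

end

theory Submission imports Defs begin

text \<open>
  The proof has an algebraic and an analytic half.

  In a commutative ring, let \<open>P = m - 1 - Q\<close> and regard the alternating sum as a polynomial in \<open>Q\<close>. A
  telescoping argument shows that it does not change under \<open>Q \<mapsto> Q + 2\<close> (\<open>A_sum_shift\<close>), so in
  characteristic zero it is constant in \<open>Q\<close>. At \<open>Q = - C\<close> all summands but one vanish and the remaining one
  is the asserted product (\<open>A_sum_at_minus_C\<close>). Together this is \<open>A_sum_eq_prod\<close>. The value \<open>- C\<close> must belong to the
  ring over which the polynomial in \<open>Q\<close> is formed, so the formula is applied to the variables of \<open>\<complex>[b][c]\<close>. If the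
  operators commute, this ring acts on the smooth functions with \<open>b\<close> and \<open>c\<close> acting as \<open>B\<close> and \<open>C\<close>, and the identity is
  transported along the action (\<open>A_op_eq_prod\<close>).

  It remains to see that \<open>B\<close> and \<open>C\<close> commute on smooth functions. Both are symmetric, and both act by
  scalars on products of spherical harmonics of the two factors. Hence \<open>B (C f) - C (B f)\<close> is \<open>L\<^sup>2\<close>-orthogonal
  to all such products. Zonal harmonics suffice to show that it is zero: they are explicit combinations of
  \<open>|x|\<^sup>2\<^sup>k (x \<bullet> a)\<^sup>d\<^sup>-\<^sup>2\<^sup>k\<close>, so on the sphere every power \<open>(x \<bullet> a)\<^sup>d\<close> is a combination of them
  (\<open>power_inner_on_sphere\<close>). Thus the difference is orthogonal to the powers of linear forms on the product space,
  to their exponentials, and by the Stone--Weierstrass theorem to all continuous functions, in particular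
  to itself (\<open>smooth_fn_eq_0_if_annihilates_zonal\<close>). A smooth function of norm zero vanishes because the measure of
  the spheres charges every nonempty relatively open set (\<open>l2_inner_self_eq_0D\<close>).
\<close>

section \<open>The product formula in a commutative ring\<close>

definition step_prod :: "'r::comm_ring_1 \<Rightarrow> 'r \<Rightarrow> nat \<Rightarrow> 'r" where
  "step_prod X Q l = (\<Prod>i<l. (X + (Q - 2 * of_nat i)) * (X + (- Q + 2 * of_nat i)))"

definition A_sum :: "nat \<Rightarrow> 'r::comm_ring_1 \<Rightarrow> 'r \<Rightarrow> 'r \<Rightarrow> 'r \<Rightarrow> 'r" where
  "A_sum m C B P Q = (\<Sum>l\<le>m. (-1) ^ (m - l) * of_nat (m choose l) * step_prod C Q l * step_prod B P (m - l))"

lemma step_prod_0 [simp]: "step_prod X Q 0 = 1"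
  by (simp add: step_prod_def)

lemma step_prod_Suc:
  "step_prod X Q (Suc l) = step_prod X Q l * (X^2 - (Q - 2 * of_nat l)^2)"
  by (simp add: step_prod_def algebra_simps power2_eq_square)

lemma step_prod_Suc_shift:
  "step_prod X (Q + 2) (Suc l) = (X^2 - (Q + 2)^2) * step_prod X Q l"
proof (induction l)
  case 0
  then show ?case by (simp add: step_prod_Suc)
next
  case (Suc l)
  have "Q + 2 - 2 * of_nat (Suc l) = Q - 2 * of_nat l" by simp
  with Suc show ?case by (simp only: step_prod_Suc[of _ _ "Suc l"] step_prod_Suc[of _ _ l] mult.assoc)
qed

text \<open>
  The identity behind independence of \<open>Q\<close>: with \<open>P + Q\<close> fixed, moving \<open>Q\<close> by \<open>2\<close> drops one factor
  of \<open>step_prod C Q l\<close> at one end and adds one at the other, and does the opposite to the factor in \<open>B\<close>.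
  So two summands with the same \<open>l\<close> have almost all factors in common, and Gosper's method writes their difference
  as a forward difference in \<open>l\<close>.
\<close>

lemma A_sum_shift:
  fixes C B P Q :: "'r::comm_ring_1"
  assumes PQ: "P + Q = of_nat m - 3"
  shows "A_sum m C B P (Q + 2) = A_sum m C B (P + 2) Q"
proof -
  define c where "c = step_prod C Q"
  define d where "d = step_prod B P"
  \<comment> \<open>The Gosper certificate. It is cut off outside \<open>1 \<le> l \<le> m\<close>, where the truncated subtractions
    in its formula have no meaning; the formula itself has a zero there, from \<open>l\<close> or from the
    binomial coefficient.\<close>
  define G where "G l = (if l = 0 \<or> l > m then 0 else
     4 * (-1) ^ (m - l) * of_nat (m choose l) * of_nat l * (Q + 2 - of_nat l) * c (l - 1) * d (m - l))" for l
  \<comment> \<open>The equation that the certificate has to satisfy once the common factors are removed. Here \<open>l'\<close> and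
    \<open>k'\<close> stand for \<open>l - 1\<close> and \<open>m - l - 1\<close>.\<close>
  have kernel: "(C^2 - (Q + 2)^2) * (B^2 - (P - 2 * k')^2) - (C^2 - (Q - 2 * l')^2) * (B^2 - (P + 2)^2)
      = - (4 * ((k' + 1) * (Q - l') * (C^2 - (Q - 2 * l')^2) + (l' + 1) * (Q + 1 - l') * (B^2 - (P - 2 * k')^2)))"
    if "P + Q = l' + k' - 1" for l' k' :: 'r
  proof -
    have P: "P = l' + k' - 1 - Q" using that by (simp add: algebra_simps)
    have 1: "C^2 - (Q + 2)^2 = (C^2 - (Q - 2 * l')^2) - 4 * (l' + 1) * (Q + 1 - l')"
      by (simp add: algebra_simps power2_eq_square)
    have 2: "B^2 - (P + 2)^2 = (B^2 - (P - 2 * k')^2) + 4 * (k' + 1) * (Q - l')"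
      by (simp add: P algebra_simps power2_eq_square)
    show ?thesis unfolding 1 2 by (simp add: algebra_simps)
  qed
  have main: "(-1) ^ (m - l) * of_nat (m choose l) *
      (step_prod C (Q + 2) l * step_prod B P (m - l) - step_prod C Q l * step_prod B (P + 2) (m - l))
      = G (Suc l) - G l" if "l \<le> m" for l
  proof (cases "l = m")
    case True
    show ?thesis
    proof (cases l)
      case (Suc l')
      have "C^2 - (Q + 2)^2 - (C^2 - (Q - 2 * of_nat l')^2) = - (4 * (of_nat l' + 1) * (Q + 1 - of_nat l'))"
        by (simp add: algebra_simps power2_eq_square)
      then have "step_prod C (Q + 2) l - step_prod C Q l
          = - (4 * (of_nat l' + 1) * (Q + 1 - of_nat l')) * step_prod C Q l'"
        unfolding Suc step_prod_Suc_shift unfolding step_prod_Suc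
        by (simp only: mult.commute[of "step_prod C Q l'"] left_diff_distrib[symmetric])
      moreover have "G (Suc l) = 0" "G l = 4 * (of_nat l' + 1) * (Q + 1 - of_nat l') * step_prod C Q l'"
        using Suc by (simp_all add: G_def c_def d_def True[symmetric] algebra_simps)
      moreover have "(-1) ^ (m - l) * of_nat (m choose l) = (1 :: 'r)" "m - l = 0" using True by simp_all
      ultimately show ?thesis using True by simp
    qed (use True in \<open>simp add: G_def\<close>)
  next
    case False
    with that obtain k' where k': "m = l + Suc k'" by (metis add_Suc_right less_imp_Suc_add le_neq_implies_less)
    show ?thesis
    proof (cases l)
      case 0
      have "B^2 - (P - 2 * of_nat k')^2 - (B^2 - (P + 2)^2) = - (4 * (of_nat k' + 1) * (Q + 1))"
      proof -
        have P: "P = of_nat k' - 2 - Q" using PQ k' 0 by (simp add: algebra_simps)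
        show ?thesis by (simp add: P algebra_simps power2_eq_square)
      qed
      then have "step_prod B P m - step_prod B (P + 2) m = - (4 * (of_nat k' + 1) * (Q + 1)) * step_prod B P k'"
        unfolding k' 0 add_0 step_prod_Suc_shift unfolding step_prod_Suc
        by (simp only: mult.commute[of _ "step_prod B P k'"] right_diff_distrib[symmetric])
      moreover define T where "T = 4 * (of_nat k' + 1) * (Q + 1) * step_prod B P k'"
      ultimately have D: "step_prod B P m - step_prod B (P + 2) m = - T"
        by (simp only: mult_minus_left)
      have "G 0 = 0" by (simp add: G_def)
      moreover have "G (Suc 0) = (-1) ^ k' * T"
        using k' 0 by (simp add: G_def c_def d_def T_def algebra_simps)
      moreover have "(-1) ^ m = - ((-1) ^ k' :: 'r)" using k' 0 by simp
      ultimately show ?thesis using D by (simp add: 0)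
    next
      case (Suc l')
      define b where "b = (of_nat (m choose l) :: 'r)"
      have b': "of_nat (m choose Suc l) * (of_nat l + 1) = b * (of_nat k' + 1)"
      proof -
        have "(m choose Suc l) * Suc l = (m choose l) * Suc k'"
        proof -
          have "m - l = Suc k'" using k' by simp
          then show ?thesis
            using binomial_absorb_comp[of m l] binomial_absorption[of l m] by (metis mult.commute)
        qed
        then show ?thesis unfolding b_def by (metis of_nat_Suc of_nat_mult add.commute)
      qed
      define X where "X = C^2 - (Q + 2)^2"
      define Y where "Y = B^2 - (P + 2)^2"
      define beta where "beta = B^2 - (P - 2 * of_nat k')^2"
      define gamma where "gamma = C^2 - (Q - 2 * of_nat l')^2"
      have K: "X * beta - gamma * Y = - (4 * ((of_nat k' + 1) * (Q - of_nat l') * gamma + (of_nat l' + 1) * (Q + 1 - of_nat l') * beta))"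
        unfolding X_def Y_def beta_def gamma_def by (rule kernel) (use PQ k' Suc in simp)
      have mk: "m - l = Suc k'" "m - Suc l = k'" "l - 1 = l'" using k' Suc by auto
      have G1: "G (Suc l) = 4 * (-1) ^ k' * (b * (of_nat k' + 1)) * (Q - of_nat l') * (c l' * gamma) * d k'"
      proof -
        have "G (Suc l) = 4 * (-1) ^ k' * (of_nat (m choose Suc l) * (of_nat l + 1)) * (Q - of_nat l') * c (Suc l') * d k'"
          using k' Suc mk by (simp add: G_def mult.assoc add.commute)
        then show ?thesis unfolding b' by (simp add: c_def step_prod_Suc gamma_def)
      qed
      have G0: "G l = - 4 * (-1) ^ k' * b * (of_nat l' + 1) * (Q + 1 - of_nat l') * c l' * (d k' * beta)"
      proof -
        have "G l = 4 * (-1) ^ Suc k' * b * of_nat l * (Q + 2 - of_nat l) * c l' * d (Suc k')"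
          using k' Suc mk by (simp add: G_def b_def)
        moreover have "Q + 2 - of_nat l = Q + 1 - of_nat l'" "of_nat l = (of_nat l' + 1 :: 'r)"
          using Suc by simp_all
        moreover have "d (Suc k') = d k' * beta" by (simp add: d_def step_prod_Suc beta_def)
        ultimately show ?thesis by (simp add: add_diff_eq add.commute)
      qed
      have "step_prod C (Q + 2) l * step_prod B P (m - l) - step_prod C Q l * step_prod B (P + 2) (m - l)
          = c l' * d k' * (X * beta - gamma * Y)"
        unfolding mk unfolding Suc step_prod_Suc_shift
        unfolding step_prod_Suc[of C] step_prod_Suc[of B P]
        unfolding c_def[symmetric] d_def[symmetric]
          X_def[symmetric] Y_def[symmetric] beta_def[symmetric] gamma_def[symmetric]
        by (simp only: right_diff_distrib mult.assoc mult.commute mult.left_commute)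
      note diff = this
      show ?thesis unfolding diff unfolding G1 G0 K mk b_def[symmetric] by (simp add: algebra_simps)
    qed
  qed
  have "A_sum m C B P (Q + 2) - A_sum m C B (P + 2) Q = (\<Sum>l\<le>m. G (Suc l) - G l)"
    unfolding A_sum_def sum_subtractf[symmetric]
    by (rule sum.cong) (simp_all add: main[symmetric] algebra_simps)
  also have "\<dots> = G (Suc m) - G 0"
    using sum_lessThan_telescope[of G "Suc m"] by (simp add: lessThan_Suc_atMost)
  also have "\<dots> = 0" by (simp add: G_def)
  finally show ?thesis by simp
qed

text \<open>
  For \<open>Q = - C\<close> the factor \<open>C + Q\<close>, present in all summands with \<open>l > 0\<close>, vanishes. The only summand left
  is already a product, and its linear factors are those of the closed form up to signs, which cancel \<open>(- 1)\<^sup>m\<close>.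
\<close>

lemma A_sum_at_minus_C:
  fixes C B :: "'r::comm_ring_1"
  shows "A_sum m C B (of_nat m - 1 + C) (- C) =
    (\<Prod>i<m. C + B + (of_nat m - 1 - 2 * of_nat i)) * (\<Prod>i<m. C - B + (of_nat m - 1 - 2 * of_nat i))"
proof -
  have z: "step_prod C (- C) l = 0" if "l > 0" for l
    using that unfolding step_prod_def by (intro prod_zero bexI[of _ 0]) auto
  have "A_sum m C B (of_nat m - 1 + C) (- C) = (\<Sum>l\<in>{0}. (-1) ^ (m - l) * of_nat (m choose l) * step_prod C (-C) l * step_prod B (of_nat m - 1 + C) (m - l))"
    unfolding A_sum_def by (rule sum.mono_neutral_right) (auto simp: z)
  also have "\<dots> = (\<Prod>i<m. - 1) * step_prod B (of_nat m - 1 + C) m" by simp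
  also have "\<dots> = (\<Prod>i<m. (C + B + (of_nat m - 1 - 2 * of_nat i)) * (C - B + (of_nat m - 1 - 2 * of_nat i)))"
    unfolding step_prod_def prod.distrib[symmetric] by (rule prod.cong) (simp_all add: algebra_simps)
  finally show ?thesis by (simp add: prod.distrib)
qed

text \<open>
  On the line \<open>P = s - Q\<close> the sum is a polynomial in \<open>Q\<close>, namely the same sum formed in the
  polynomial ring.
\<close>

lemma A_sum_poly:
  fixes C B s :: "'r::comm_ring_1"
  shows "A_sum m C B (s - Q) Q = poly (A_sum m [:C:] [:B:] [:s, -1:] [:0, 1:]) Q"
proof -
  have k: "poly (of_nat i :: 'r poly) x = of_nat i" for i x by (simp add: of_nat_poly)
  have "poly (step_prod [:C:] [:0, 1:] l) Q = step_prod C Q l" 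
    "poly (step_prod [:B:] [:s, -1:] l) Q = step_prod B (s - Q) l" for l
    by (simp_all add: step_prod_def poly_prod k algebra_simps)
  then show ?thesis
    by (simp add: A_sum_def poly_sum k algebra_simps)
qed

text \<open>
  A polynomial in \<open>Q\<close> that is invariant under \<open>Q \<mapsto> Q + 2\<close> takes one value infinitely often in
  characteristic zero, hence is constant over a domain, so it may be evaluated at \<open>Q = - C\<close>.
\<close>

theorem A_sum_eq_prod:
  fixes C B P Q :: "'r::{idom, ring_char_0}"
  assumes PQ: "P + Q = of_nat m - 1"
  shows "A_sum m C B P Q =
    (\<Prod>i<m. C + B + (of_nat m - 1 - 2 * of_nat i)) * (\<Prod>i<m. C - B + (of_nat m - 1 - 2 * of_nat i))"
proof -
  define s :: 'r where "s = of_nat m - 1"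
  define F where "F = A_sum m [:C:] [:B:] [:s, -1:] [:0, 1:]"
  have F: "poly F x = A_sum m C B (s - x) x" for x
    by (simp add: F_def A_sum_poly)
  have step: "poly F (x + 2) = poly F x" for x
    using A_sum_shift[of "s - (x + 2)" x m C B] by (simp add: F s_def algebra_simps)
  have per: "poly F (Q + 2 * of_nat i) = poly F Q" for i
  proof (induction i)
    case (Suc i)
    have "Q + 2 * of_nat (Suc i) = Q + 2 * of_nat i + 2" by (simp add: algebra_simps)
    then show ?case using Suc step by (simp only:)
  qed simp
  have "F - [:poly F Q:] = 0"
  proof (rule ccontr)
    assume "F - [:poly F Q:] \<noteq> 0"
    then have "finite {x. poly (F - [:poly F Q:]) x = 0}" by (rule poly_roots_finite)
    moreover have "range (\<lambda>i. Q + 2 * of_nat i) \<subseteq> {x. poly (F - [:poly F Q:]) x = 0}"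
      using per by auto
    moreover have "inj (\<lambda>i. Q + 2 * of_nat i)" by (auto intro!: injI)
    ultimately show False using finite_subset range_inj_infinite by blast
  qed
  then have F_const: "F = [:poly F Q:]" by simp
  have "poly F (- C) = poly F Q" by (subst F_const) simp
  moreover have "P = s - Q" using PQ by (simp add: s_def eq_diff_eq)
  ultimately show ?thesis using A_sum_at_minus_C[of m C B] by (simp add: F s_def)
qed

section \<open>Polynomials in two commuting operators\<close>

text \<open>
  Modules whose carrier is a subset of a type: the operators are only controlled on the smooth
  functions, so every law is restricted to \<open>V\<close>.
\<close>

locale module_on =
  fixes V :: "'f::ab_group_add set" and smul :: "'r::comm_ring_1 \<Rightarrow> 'f \<Rightarrow> 'f"
  assumes zero_mem: "0 \<in> V"
    and add_mem: "f \<in> V \<Longrightarrow> g \<in> V \<Longrightarrow> f + g \<in> V"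
    and smul_mem: "f \<in> V \<Longrightarrow> smul a f \<in> V"
    and smul_add_right: "f \<in> V \<Longrightarrow> g \<in> V \<Longrightarrow> smul a (f + g) = smul a f + smul a g"
    and smul_add_left: "f \<in> V \<Longrightarrow> smul (a + b) f = smul a f + smul b f"
    and smul_smul: "f \<in> V \<Longrightarrow> smul a (smul b f) = smul (a * b) f"
    and smul_one: "f \<in> V \<Longrightarrow> smul 1 f = f"
begin

definition endo :: "('f \<Rightarrow> 'f) \<Rightarrow> bool" where
  "endo X \<longleftrightarrow> (\<forall>f\<in>V. X f \<in> V) \<and> (\<forall>f\<in>V. \<forall>g\<in>V. X (f + g) = X f + X g) \<and>
     (\<forall>f\<in>V. \<forall>a. X (smul a f) = smul a (X f))"

lemma smul_zero_left: "f \<in> V \<Longrightarrow> smul 0 f = 0"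
  using smul_add_left[of f 0 0] by simp

lemma smul_zero_right: "smul a 0 = 0"
  using smul_add_right[of 0 0 a] zero_mem by simp

lemma endo_zero: "endo X \<Longrightarrow> X 0 = 0"
  unfolding endo_def using zero_mem by (metis add_cancel_right_right)

text \<open>
  Horner's scheme for the action of the polynomial ring in which the variable acts as \<open>X\<close>.
\<close>

definition poly_act :: "('f \<Rightarrow> 'f) \<Rightarrow> 'r poly \<Rightarrow> 'f \<Rightarrow> 'f" where
  "poly_act X p f = fold_coeffs (\<lambda>a g. smul a f + X g) p 0"

lemma poly_act_0 [simp]: "poly_act X 0 f = 0"
  by (simp add: poly_act_def)

context
  fixes X assumes X: "endo X"
begin

lemma X_mem: "f \<in> V \<Longrightarrow> X f \<in> V"
  and X_add: "f \<in> V \<Longrightarrow> g \<in> V \<Longrightarrow> X (f + g) = X f + X g"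
  and X_smul: "f \<in> V \<Longrightarrow> X (smul a f) = smul a (X f)"
  using X by (auto simp: endo_def)

lemma poly_act_pCons: "f \<in> V \<Longrightarrow> poly_act X (pCons a p) f = smul a f + X (poly_act X p f)"
  by (cases "p = 0"; cases "a = 0") (simp_all add: poly_act_def smul_zero_left endo_zero[OF X])

lemma poly_act_mem: "f \<in> V \<Longrightarrow> poly_act X p f \<in> V"
  by (induction p) (simp_all add: poly_act_pCons zero_mem add_mem smul_mem X_mem)

lemma poly_act_const: "f \<in> V \<Longrightarrow> poly_act X [:a:] f = smul a f"
  by (simp add: poly_act_pCons endo_zero[OF X])

lemma poly_act_X: "f \<in> V \<Longrightarrow> poly_act X [:0, 1:] f = X f"
  by (simp add: poly_act_pCons endo_zero[OF X] smul_zero_left smul_one)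

lemma poly_act_add_right:
  "f \<in> V \<Longrightarrow> g \<in> V \<Longrightarrow> poly_act X p (f + g) = poly_act X p f + poly_act X p g"
  by (induction p)
    (simp_all add: poly_act_pCons add_mem smul_add_right X_add poly_act_mem add_ac)

lemma poly_act_add_left:
  "f \<in> V \<Longrightarrow> poly_act X (p + q) f = poly_act X p f + poly_act X q f"
  by (induction p q rule: poly_induct2)
    (simp_all add: poly_act_pCons smul_add_left X_add poly_act_mem add_ac)

lemma poly_act_commute:
  assumes Y: "endo Y" and YX: "\<And>f. f \<in> V \<Longrightarrow> Y (X f) = X (Y f)" and f: "f \<in> V"
  shows "Y (poly_act X p f) = poly_act X p (Y f)"
proof (induction p)
  case (pCons a p)
  then show ?case
    using Y f by (simp add: endo_def poly_act_pCons YX poly_act_mem smul_mem X_mem)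
qed (simp add: endo_zero[OF Y])

lemma poly_act_smul: "f \<in> V \<Longrightarrow> poly_act X (smult a p) f = smul a (poly_act X p f)"
  by (induction p) 
    (simp_all add: poly_act_pCons smul_zero_right smul_add_right smul_mem X_mem poly_act_mem smul_smul X_smul)

lemma poly_act_poly_act: "f \<in> V \<Longrightarrow> poly_act X p (poly_act X q f) = poly_act X (p * q) f"
  by (induction p)
    (simp_all add: poly_act_pCons poly_act_mem poly_act_add_left poly_act_smul smul_zero_left)

text \<open>
  Since the action is again a module, the construction can be iterated: a second endomorphism that
  commutes with \<open>X\<close> makes \<open>V\<close> a module over polynomials in two variables.
\<close>

lemma poly_act_module: "module_on V (poly_act X)"
proof
  show "poly_act X 1 f = f" if "f \<in> V" for f
    using that by (simp add: one_pCons poly_act_const smul_one)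
qed (simp_all add: zero_mem add_mem poly_act_mem poly_act_add_right poly_act_add_left poly_act_poly_act)

end
end

lemma op_prod_Suc: "op_prod T (Suc n) = op_prod T n \<circ> T n"
proof -
  have "foldr (\<circ>) xs g = foldr (\<circ>) xs id \<circ> g" for xs and g :: "('a \<times> 'b \<Rightarrow> complex) \<Rightarrow> 'a \<times> 'b \<Rightarrow> complex"
    by (induction xs) (simp_all add: comp_assoc)
  from this[of "map T [0..<n]" "T n"] show ?thesis by (simp add: op_prod_def)
qed

lemma op_prod_module:
  assumes "module_on V act" "\<And>i f. f \<in> V \<Longrightarrow> T i f = act (t i) f" "f \<in> V"
  shows "op_prod T n f = act (\<Prod>i<n. t i) f"
proof -
  interpret module_on V act by fact
  show ?thesis
    using \<open>f \<in> V\<close>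
  proof (induction n arbitrary: f)
    case 0
    then show ?case by (simp add: op_prod_def smul_one)
  next
    case (Suc n)
    then show ?case by (simp add: op_prod_Suc assms(2) smul_mem smul_smul)
  qed
qed

lemma module_sum:
  assumes "module_on V act" "f \<in> V"
  shows "(\<Sum>i\<in>I. act (t i) f) = act (\<Sum>i\<in>I. t i) f"
proof -
  interpret module_on V act by fact
  show ?thesis using assms(2)
    by (induction I rule: infinite_finite_induct) (simp_all add: smul_zero_left smul_add_left)
qed

lemma sum_fun_apply: "(\<Sum>i\<in>I. F i) f = (\<Sum>i\<in>I. F i f)"
  for F :: "'i \<Rightarrow> 'f \<Rightarrow> 'g::ab_group_add"
  by (induction I rule: infinite_finite_induct) simp_all

text \<open>
  Commuting endomorphisms \<open>B\<close> and \<open>C\<close> make \<open>V\<close> a module over \<open>\<complex>[b][c]\<close>, which is a domain of characteristic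
  zero. Both sides of the operator identity are the actions of the corresponding elements of this ring,
  and those elements agree.
\<close>

theorem A_op_eq_prod:
  fixes V :: "('a \<times> 'b \<Rightarrow> complex) set" and B C :: "('a, 'b) operator"
  assumes V: "module_on V scalar_op"
    and B: "module_on.endo V scalar_op B" and C: "module_on.endo V scalar_op C"
    and BC: "\<And>f. f \<in> V \<Longrightarrow> B (C f) = C (B f)"
    and PQ: "P + Q = of_nat m - 1"
    and f: "f \<in> V"
  shows "A_op m C B P Q f =
       (op_prod (\<lambda>i. C + B + scalar_op (of_nat m - 1 - 2 * of_nat i)) m \<circ>
        op_prod (\<lambda>i. C - B + scalar_op (of_nat m - 1 - 2 * of_nat i)) m) f"
proof -
  interpret V: module_on V scalar_op by fact
  define actB where "actB = V.poly_act B"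
  interpret VB: module_on V actB
    unfolding actB_def by (rule V.poly_act_module[OF B])
  have CB: "VB.endo C"
    using C V.poly_act_commute[OF B C BC[symmetric]] unfolding VB.endo_def V.endo_def unfolding actB_def by blast
  define act where "act = VB.poly_act C"
  have act: "module_on V act"
    unfolding act_def by (rule VB.poly_act_module[OF CB])
  interpret VC: module_on V act by fact
  define k :: "complex \<Rightarrow> complex poly poly" where "k z = [:[:z:]:]" for z
  define c b :: "complex poly poly" where "c = [:0, 1:]" and "b = [:[:0, 1:]:]"
  have act_k: "act (k z) g = scalar_op z g" and act_b: "act b g = B g" and act_c: "act c g = C g"
    if "g \<in> V" for z g
  proof -
    have "act [:p:] g = actB p g" for p
      using that by (simp add: act_def VB.poly_act_const[OF CB])
    moreover have "actB [:z:] g = scalar_op z g" "actB [:0, 1:] g = B g"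
      using that by (simp_all add: actB_def V.poly_act_const[OF B] V.poly_act_X[OF B])
    ultimately show "act (k z) g = scalar_op z g" "act b g = B g"
      by (simp_all add: k_def b_def)
    show "act c g = C g"
      using that by (simp add: act_def c_def VB.poly_act_X[OF CB])
  qed
  have k1: "k 1 = 1" by (simp add: k_def one_pCons)
  have k_simps: "k (x + y) = k x + k y" "k (x - y) = k x - k y" "k (- x) = - k x"
    "k (x * y) = k x * k y" for x y
    by (simp_all add: k_def)
  have k_power: "k (x ^ j) = k x ^ j" for x j
    by (induction j) (simp_all add: k1 k_simps)
  have k_of_nat: "k (of_nat j) = of_nat j" for j
    by (induction j) (simp_all add: k1 k_simps, simp add: k_def)
  have k_2: "k 2 = 2" using k_of_nat[of 2] by simp
  note k = k1 k_simps k_power k_of_nat k_2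
  have act_diff: "act (x - y) g = act x g - act y g" if "g \<in> V" for x y g
    using VC.smul_add_left[OF that, of "x - y" y] by simp
  have step: "op_prod (\<lambda>i. (X + scalar_op (R - 2 * of_nat i)) \<circ> (X + scalar_op (- R + 2 * of_nat i))) l g
      = act (step_prod x (k R) l) g"
    if X: "\<And>g. g \<in> V \<Longrightarrow> X g = act x g" and g: "g \<in> V" for X x R l g
    unfolding step_prod_def
  proof (rule op_prod_module[OF act _ g])
    fix i g assume g: "g \<in> V"
    have "(X + scalar_op z) h = act (x + k z) h" if "h \<in> V" for h z
      using that by (simp add: VC.smul_add_left X act_k)
    then show "((X + scalar_op (R - 2 * of_nat i)) \<circ> (X + scalar_op (- R + 2 * of_nat i))) g =
         act ((x + (k R - 2 * of_nat i)) * (x + (- k R + 2 * of_nat i))) g"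
      using g by (simp add: VC.smul_mem VC.smul_smul k)
  qed
  have "A_op m C B P Q f = act (A_sum m c b (k P) (k Q)) f"
    unfolding A_op_def sum_fun_apply[where f = f] A_sum_def module_sum[OF act f, symmetric] atLeast0AtMost
  proof (rule sum.cong)
    fix l
    show "(scalar_op ((-1) ^ (m - l) * of_nat (m choose l)) \<circ>
       op_prod (\<lambda>i. (C + scalar_op (Q - 2 * of_nat i)) \<circ> (C + scalar_op (- Q + 2 * of_nat i))) l \<circ>
       op_prod (\<lambda>i. (B + scalar_op (P - 2 * of_nat i)) \<circ> (B + scalar_op (- P + 2 * of_nat i))) (m - l)) f =
      act ((-1) ^ (m - l) * of_nat (m choose l) * step_prod c (k Q) l * step_prod b (k P) (m - l)) f"
    proof -
      have z: "scalar_op ((-1) ^ (m - l) * of_nat (m choose l)) g = act ((-1) ^ (m - l) * of_nat (m choose l)) g"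
        if "g \<in> V" for g
        using act_k[OF that, symmetric] by (simp only: k)
      show ?thesis
        using f by (simp only: comp_apply step[OF act_b[symmetric]] step[OF act_c[symmetric]] z
            VC.smul_mem VC.smul_smul mult.assoc)
    qed
  qed simp
  also have "A_sum m c b (k P) (k Q) = (\<Prod>i<m. c + b + (of_nat m - 1 - 2 * of_nat i)) * (\<Prod>i<m. c - b + (of_nat m - 1 - 2 * of_nat i))"
    by (rule A_sum_eq_prod) (simp add: k[symmetric] PQ del: of_nat_poly)
  also have "act \<dots> f = (op_prod (\<lambda>i. C + B + scalar_op (of_nat m - 1 - 2 * of_nat i)) m \<circ>
        op_prod (\<lambda>i. C - B + scalar_op (of_nat m - 1 - 2 * of_nat i)) m) f"
  proof -
    have 1: "(C + B + scalar_op (of_nat m - 1 - 2 * of_nat i)) g = act (c + b + (of_nat m - 1 - 2 * of_nat i)) g"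
      "(C - B + scalar_op (of_nat m - 1 - 2 * of_nat i)) g = act (c - b + (of_nat m - 1 - 2 * of_nat i)) g"
      if "g \<in> V" for i g
    proof -
      have e: "of_nat m - 1 - 2 * of_nat i = k (of_nat m - 1 - 2 * of_nat i)" by (simp add: k)
      show "(C + B + scalar_op (of_nat m - 1 - 2 * of_nat i)) g = act (c + b + (of_nat m - 1 - 2 * of_nat i)) g"
        "(C - B + scalar_op (of_nat m - 1 - 2 * of_nat i)) g = act (c - b + (of_nat m - 1 - 2 * of_nat i)) g"
        unfolding e using that by (simp_all add: VC.smul_add_left act_diff act_b act_c act_k)
    qed
    show ?thesis
      using f by (simp add: op_prod_module[OF act 1(1)] op_prod_module[OF act 1(2)] VC.smul_mem VC.smul_smul)
  qed
  finally show ?thesis .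
qed

section \<open>Smooth functions on the product of the spheres\<close>

lemma Ck_on_imp_continuous_on: "Ck_on k U F \<Longrightarrow> continuous_on U F"
  by (cases k) (auto intro!: continuous_at_imp_continuous_on differentiable_imp_continuous_within)

lemma Ck_on_SucD: "Ck_on (Suc k) U F \<Longrightarrow> Ck_on k U F"
proof (induction k arbitrary: F)
  case 0
  then show ?case using Ck_on_imp_continuous_on[OF 0] by simp
qed auto

lemma Ck_on_mono: "Ck_on k U F \<Longrightarrow> W \<subseteq> U \<Longrightarrow> Ck_on k W F"
  by (induction k arbitrary: F) (auto intro: continuous_on_subset)

lemma Ck_on_cong:
  assumes "open U" "\<And>x. x \<in> U \<Longrightarrow> F x = G x" "Ck_on k U F"
  shows "Ck_on k U G"
  using assms(2,3)
proof (induction k arbitrary: F G)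
  case 0
  then show ?case using continuous_on_cong by fastforce
next
  case (Suc k)
  have eq: "frechet_derivative F (at x) = frechet_derivative G (at x)" if "x \<in> U" for x
    using Suc.prems that \<open>open U\<close> by (intro frechet_derivative_transform_within_open) auto
  moreover have "G differentiable (at x)" if "x \<in> U" for x
  proof -
    have "(F has_derivative frechet_derivative F (at x)) (at x)"
      using Suc.prems(2) that by (simp add: frechet_derivative_works)
    then have "(G has_derivative frechet_derivative F (at x)) (at x)"
      by (rule has_derivative_transform_within_open[OF _ \<open>open U\<close> that]) (rule Suc.prems(1))
    then show ?thesis by (rule differentiableI)
  qed
  moreover have "Ck_on k U (\<lambda>x. frechet_derivative G (at x) w)" for w
  proof (rule Suc.IH)
    show "Ck_on k U (\<lambda>x. frechet_derivative F (at x) w)" using Suc.prems(2) by simp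
  qed (simp only: eq)
  ultimately show ?case by simp
qed

lemma Ck_on_const: "Ck_on k U (\<lambda>x. c)"
  by (induction k arbitrary: c) auto

lemma Ck_on_bounded_linear:
  assumes "bounded_linear F" shows "Ck_on k U F"
proof (cases k)
  case (Suc l)
  have "frechet_derivative F (at x) = F" for x
    using frechet_derivative_at[OF bounded_linear_imp_has_derivative[OF assms]] by simp
  then show ?thesis
    using assms by (simp add: Suc Ck_on_const bounded_linear_imp_differentiable)
qed (use assms in \<open>simp add: linear_continuous_on\<close>)

lemma Ck_on_add:
  assumes "open U" "Ck_on k U F" "Ck_on k U G"
  shows "Ck_on k U (\<lambda>x. F x + G x)"
  using assms(2,3)
proof (induction k arbitrary: F G)
  case (Suc k)
  have d: "frechet_derivative (\<lambda>x. F x + G x) (at x) =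
      (\<lambda>w. frechet_derivative F (at x) w + frechet_derivative G (at x) w)" if "x \<in> U" for x
    using Suc.prems that
    by (intro frechet_derivative_at[symmetric] has_derivative_add) (auto simp: frechet_derivative_works[symmetric])
  have "Ck_on k U (\<lambda>x. frechet_derivative F (at x) w + frechet_derivative G (at x) w)" for w
    using Suc.prems by (intro Suc.IH) simp_all
  then have "Ck_on k U (\<lambda>x. frechet_derivative (\<lambda>x. F x + G x) (at x) w)" for w
    by (rule Ck_on_cong[OF \<open>open U\<close>, rotated]) (simp add: d)
  moreover have "(\<lambda>x. F x + G x) differentiable (at x)" if "x \<in> U" for x
    using Suc.prems that by (simp add: differentiable_add)
  ultimately show ?case by simp
qed (auto intro: continuous_on_add)

lemma Ck_on_mult:
  assumes "open U" "Ck_on k U F" "Ck_on k U G"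
  shows "Ck_on k U (\<lambda>x. F x * G x)"
  using assms(2,3)
proof (induction k arbitrary: F G)
  case (Suc k)
  have d: "frechet_derivative (\<lambda>x. F x * G x) (at x) =
      (\<lambda>w. F x * frechet_derivative G (at x) w + frechet_derivative F (at x) w * G x)" if "x \<in> U" for x
    using Suc.prems that
    by (intro frechet_derivative_at[symmetric] has_derivative_mult) (auto simp: frechet_derivative_works[symmetric])
  have "Ck_on k U (\<lambda>x. F x * frechet_derivative G (at x) w + frechet_derivative F (at x) w * G x)" for w
    using Suc.prems Ck_on_SucD[OF Suc.prems(1)] Ck_on_SucD[OF Suc.prems(2)]
    by (intro Ck_on_add[OF \<open>open U\<close>] Suc.IH) simp_all
  then have "Ck_on k U (\<lambda>x. frechet_derivative (\<lambda>x. F x * G x) (at x) w)" for w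
    by (rule Ck_on_cong[OF \<open>open U\<close>, rotated]) (simp add: d)
  moreover have "(\<lambda>x. F x * G x) differentiable (at x)" if "x \<in> U" for x
    using Suc.prems that by (simp add: differentiable_mult)
  ultimately show ?case by simp
qed (auto intro: continuous_on_mult)

lemma smooth_on_real_polynomial:
  assumes "real_polynomial_function g" "open U"
  shows "smooth_on U (\<lambda>x. complex_of_real (g x))"
  unfolding smooth_on_def
proof
  fix k
  show "Ck_on k U (\<lambda>x. complex_of_real (g x))"
    using assms(1)
  proof induction
    case (linear f)
    then show ?case
      by (intro Ck_on_bounded_linear bounded_linear_compose[OF bounded_linear_of_real])
  qed (use \<open>open U\<close> in \<open>auto intro: Ck_on_const Ck_on_add Ck_on_mult\<close>)
qed

lemma smooth_fnsI:
  assumes "\<And>z. z \<notin> sphere_prod \<Longrightarrow> f z = 0" "open U" "sphere_prod \<subseteq> U" "smooth_on U F"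
    "\<And>z. z \<in> sphere_prod \<Longrightarrow> f z = F z"
  shows "f \<in> smooth_fns"
  using assms unfolding smooth_fns_def by blast

lemma smooth_fnsE:
  assumes "f \<in> smooth_fns"
  obtains U F where "open U" "sphere_prod \<subseteq> U" "smooth_on U F"
    "\<forall>z\<in>sphere_prod. f z = F z"
  using assms unfolding smooth_fns_def by blast

lemma smooth_fns_vanish: "f \<in> smooth_fns \<Longrightarrow> z \<notin> sphere_prod \<Longrightarrow> f z = 0"
  unfolding smooth_fns_def by blast

lemma smooth_fns_continuous_on:
  assumes "f \<in> smooth_fns"
  shows "continuous_on sphere_prod f"
proof -
  obtain U F where "open U" "sphere_prod \<subseteq> U" "smooth_on U F" and F: "\<forall>z\<in>sphere_prod. f z = F z"
    using assms by (rule smooth_fnsE)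
  then have "continuous_on sphere_prod F"
    using Ck_on_imp_continuous_on continuous_on_subset unfolding smooth_on_def by blast
  then show ?thesis using F continuous_on_cong by blast
qed

lemma smooth_fns_add:
  assumes f: "f \<in> smooth_fns" and g: "g \<in> smooth_fns"
  shows "f + g \<in> smooth_fns"
proof -
  obtain U F where F: "open U" "sphere_prod \<subseteq> U" "smooth_on U F" "\<forall>z\<in>sphere_prod. f z = F z"
    using f by (rule smooth_fnsE)
  obtain W G where G: "open W" "sphere_prod \<subseteq> W" "smooth_on W G" "\<forall>z\<in>sphere_prod. g z = G z"
    using g by (rule smooth_fnsE)
  have UW: "open (U \<inter> W)" using F G by blast
  have "Ck_on k (U \<inter> W) (\<lambda>z. F z + G z)" for k
    using F(3) G(3) Ck_on_mono[of k U F "U \<inter> W"] Ck_on_mono[of k W G "U \<inter> W"]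
    by (intro Ck_on_add[OF UW]) (simp_all add: smooth_on_def)
  then have "smooth_on (U \<inter> W) (\<lambda>z. F z + G z)" by (simp add: smooth_on_def)
  then show ?thesis
    using F(2) G(2) by (intro smooth_fnsI[OF _ UW]) (simp_all add: smooth_fns_vanish f g F(4) G(4))
qed

lemma smooth_fns_scalar_op:
  assumes f: "f \<in> smooth_fns"
  shows "scalar_op c f \<in> smooth_fns"
proof -
  obtain U F where F: "open U" "sphere_prod \<subseteq> U" "smooth_on U F" "\<forall>z\<in>sphere_prod. f z = F z"
    using f by (rule smooth_fnsE)
  have "smooth_on U (\<lambda>z. c * F z)"
    using F(3) unfolding smooth_on_def by (simp add: Ck_on_mult[OF F(1)] Ck_on_const)
  then show ?thesis
    by (intro smooth_fnsI[OF _ F(1,2)]) (simp_all add: scalar_op_def smooth_fns_vanish f F(4))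
qed

lemma smooth_fns_polynomial:
  assumes "real_polynomial_function g"
  shows "(\<lambda>z. if z \<in> sphere_prod then complex_of_real (g z) else 0) \<in> smooth_fns"
  by (rule smooth_fnsI[OF _ open_UNIV _ smooth_on_real_polynomial[OF assms open_UNIV]]) simp_all

lemma zero_in_smooth_fns: "0 \<in> smooth_fns"
  using smooth_fns_polynomial[OF real_polynomial_function.intros(2)[of 0]] by (simp add: zero_fun_def cong: if_cong)

lemma compact_sphere_prod: "compact sphere_prod"
  by (simp add: sphere_prod_def compact_Times)

section \<open>The inner product is definite on smooth functions\<close>

lemma sets_sphere_measure [simp, measurable_cong]: "sets sphere_measure = sets borel"
  by (simp add: sphere_measure_def)

lemma space_sphere_measure [simp]: "space sphere_measure = UNIV"
  using sets_eq_imp_space_eq[OF sets_sphere_measure] by simp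

lemma emeasure_sphere_measure:
  fixes S :: "'e::euclidean_space set"
  assumes "S \<in> sets borel"
  shows "emeasure sphere_measure S = of_nat DIM('e) * emeasure lborel {x \<in> ball 0 1. x /\<^sub>R norm x \<in> S}"
proof -
  have "(\<lambda>x::'e. x /\<^sub>R norm x) \<in> restrict_space lborel (ball 0 1) \<rightarrow>\<^sub>M borel"
    by (intro measurable_restrict_space1) simp
  moreover have "emeasure (restrict_space lborel (ball 0 1)) {x \<in> ball 0 1. x /\<^sub>R norm x \<in> S} =
      emeasure lborel {x::'e \<in> ball 0 1. x /\<^sub>R norm x \<in> S}"
    by (rule emeasure_restrict_space) auto
  moreover have "(\<lambda>x::'e. x /\<^sub>R norm x) -` S \<inter> space (restrict_space lborel (ball 0 1)) =
      {x \<in> ball 0 1. x /\<^sub>R norm x \<in> S}"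
    by (auto simp: space_restrict_space)
  ultimately show ?thesis
    using assms unfolding sphere_measure_def by (simp only: emeasure_scale_measure emeasure_distr)
qed

lemma finite_measure_sphere_measure: "finite_measure (sphere_measure :: 'e::euclidean_space measure)"
proof
  have "emeasure lborel (ball (0::'e) 1) < \<infinity>" by (rule emeasure_lborel_ball_finite)
  moreover have "{x::'e \<in> ball 0 1. x /\<^sub>R norm x \<in> UNIV} = ball 0 1" by auto
  then have "emeasure (sphere_measure :: 'e measure) UNIV = of_nat DIM('e) * emeasure lborel (ball (0::'e) 1)"
    using emeasure_sphere_measure[of "UNIV :: 'e set"] by (simp only: sets.top space_borel[symmetric])
  ultimately show "emeasure (sphere_measure :: 'e measure) (space sphere_measure) \<noteq> \<infinity>"
    by (simp add: ennreal_mult_eq_top_iff)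
qed

text \<open>
  The cone over a relatively open part of the sphere is open in the punctured ball, and a nonempty open
  set is not a null set.
\<close>

lemma emeasure_sphere_measure_pos:
  fixes U :: "'e::euclidean_space set"
  assumes "open U" "x \<in> U" "x \<in> sphere 0 1"
  shows "emeasure sphere_measure (U \<inter> sphere 0 1) > 0"
proof -
  define W where "W = {y \<in> ball 0 1 - {0}. y /\<^sub>R norm y \<in> U}"
  have "open W"
  proof -
    have "continuous_on (ball 0 1 - {0::'e}) (\<lambda>y. y /\<^sub>R norm y)"
      by (intro continuous_intros) auto
    then have "open ((ball 0 1 - {0}) \<inter> (\<lambda>y. y /\<^sub>R norm y) -` U)"
      using \<open>open U\<close> by (intro continuous_open_preimage) auto
    then show ?thesis by (simp add: W_def vimage_def Int_def)
  qed
  moreover have "x /\<^sub>R 2 \<in> W" using assms by (auto simp: W_def)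
  ultimately have "emeasure lborel W \<noteq> 0"
    using open_not_negligible[of W] null_sets_completionI[of W lborel]
    by (auto simp: negligible_iff_null_sets null_sets_def)
  moreover have "W = {y \<in> ball 0 1. y /\<^sub>R norm y \<in> U \<inter> sphere 0 1}"
    by (auto simp: W_def)
  ultimately show ?thesis
    using \<open>open U\<close> by (simp add: emeasure_sphere_measure ennreal_zero_less_mult_iff zero_less_iff_neq_zero DIM_positive)
qed

lemma sets_product_measure [measurable_cong]:
  "sets (sphere_measure \<Otimes>\<^sub>M sphere_measure :: ('a::euclidean_space \<times> 'b::euclidean_space) measure) = sets borel"
  by (simp add: borel_prod[symmetric] cong: sets_pair_measure_cong)

lemma finite_measure_product: 
  "finite_measure (sphere_measure \<Otimes>\<^sub>M sphere_measure :: ('a::euclidean_space \<times> 'b::euclidean_space) measure)"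
  by (intro finite_measure_pair_measure finite_measure_sphere_measure)

lemma integrable_product:
  fixes f :: "'a::euclidean_space \<times> 'b::euclidean_space \<Rightarrow> complex"
  assumes c: "continuous_on sphere_prod f" and z: "\<And>z. z \<notin> sphere_prod \<Longrightarrow> f z = 0"
  shows "integrable (sphere_measure \<Otimes>\<^sub>M sphere_measure) f"
proof -
  interpret finite_measure "sphere_measure \<Otimes>\<^sub>M sphere_measure :: ('a \<times> 'b) measure"
    by (rule finite_measure_product)
  have "f = (\<lambda>x. indicator sphere_prod x *\<^sub>R f x)"
    using z by (auto simp: indicator_def fun_eq_iff)
  moreover have "(\<lambda>x. indicator sphere_prod x *\<^sub>R f x) \<in> borel_measurable borel"
    using compact_sphere_prod c
    by (intro borel_measurable_continuous_on_indicator) (auto intro: borel_closed compact_imp_closed)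
  ultimately have m: "f \<in> borel_measurable (sphere_measure \<Otimes>\<^sub>M sphere_measure)"
    using measurable_cong_sets[OF sets_product_measure refl] by metis
  have "bounded (f ` sphere_prod)"
    using compact_continuous_image[OF c compact_sphere_prod] compact_imp_bounded by blast
  then obtain K where K: "\<And>x. x \<in> sphere_prod \<Longrightarrow> norm (f x) \<le> K" "K > 0"
    by (auto simp: bounded_pos)
  then have "norm (f x) \<le> K" for x by (cases "x \<in> sphere_prod") (auto simp: z)
  then show ?thesis using m by (intro integrable_const_bound[of _ K]) simp_all
qed

text \<open>
  A smooth function that is nonzero somewhere is nonzero on a relatively open rectangle, which has
  positive measure.
\<close>

lemma l2_inner_self_eq_0D:
  fixes h :: "'a::euclidean_space \<times> 'b::euclidean_space \<Rightarrow> complex"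
  assumes h: "h \<in> smooth_fns" and 0: "l2_inner h h = 0"
  shows "h = 0"
proof (rule ccontr)
  let ?M = "sphere_measure \<Otimes>\<^sub>M sphere_measure :: ('a \<times> 'b) measure"
  interpret B: finite_measure "sphere_measure :: 'b measure" by (rule finite_measure_sphere_measure)
  assume "h \<noteq> 0"
  then obtain z where z: "h z \<noteq> 0" by (auto simp: fun_eq_iff)
  then have zS: "z \<in> sphere_prod" using smooth_fns_vanish[OF h] by blast
  have cont: "continuous_on sphere_prod h" by (rule smooth_fns_continuous_on[OF h])
  have eq: "h z * cnj (h z) = of_real ((cmod (h z))^2)" for z
    by (rule complex_norm_square[symmetric])
  have int: "integrable ?M (\<lambda>z. h z * cnj (h z))"
    by (rule integrable_product) (auto intro!: continuous_intros cont simp: smooth_fns_vanish[OF h])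
  then have int2: "integrable ?M (\<lambda>z. (cmod (h z))^2)"
    unfolding eq using integrable_Re by fastforce
  have "(\<integral>z. (cmod (h z))^2 \<partial>?M) = 0"
  proof -
    have "complex_of_real (\<integral>z. (cmod (h z))^2 \<partial>?M) = 0"
      unfolding integral_complex_of_real[symmetric] eq[symmetric] using 0 by (simp only: l2_inner_def)
    then show ?thesis by (simp only: of_real_eq_0_iff)
  qed
  then have "AE z in ?M. (cmod (h z))^2 = 0"
    using integral_nonneg_eq_0_iff_AE[OF int2] by simp
  then have ae: "AE z in ?M. h z = 0" by simp
  obtain W where W: "open W" "W \<inter> sphere_prod = (h -` (- {0})) \<inter> sphere_prod"
    using cont[unfolded continuous_on_open_invariant, rule_format, of "- {0}"] by auto
  then have "z \<in> W" using z zS by auto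
  then obtain U V where UV: "open U" "open V" "z \<in> U \<times> V" "U \<times> V \<subseteq> W"
    using \<open>open W\<close> open_prod_elim by metis
  define R where "R = (U \<inter> sphere 0 1) \<times> (V \<inter> sphere 0 1)"
  have Uz: "fst z \<in> U" "fst z \<in> sphere 0 1" "snd z \<in> V" "snd z \<in> sphere 0 1"
    using UV(3) zS by (auto simp: sphere_prod_def)
  have "emeasure ?M R = emeasure sphere_measure (U \<inter> sphere 0 1) * emeasure sphere_measure (V \<inter> sphere 0 1)"
    unfolding R_def using UV by (intro B.emeasure_pair_measure_Times) auto
  also have "\<dots> > 0"
    using emeasure_sphere_measure_pos[OF UV(1) Uz(1,2)] emeasure_sphere_measure_pos[OF UV(2) Uz(3,4)]
    by (simp add: ennreal_zero_less_mult_iff)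
  finally have pos: "emeasure ?M R > 0" .
  have "R \<subseteq> {z. h z \<noteq> 0}" using W(2) UV(4) by (auto simp: R_def sphere_prod_def)
  moreover have "R \<in> sets ?M" unfolding R_def using UV by (intro pair_measureI) auto
  ultimately have "AE z in ?M. z \<notin> R" using ae by (auto elim: eventually_mono)
  then have "emeasure ?M R = 0"
    using AE_iff_null_sets[OF \<open>R \<in> sets ?M\<close>] by (simp add: null_setsD1)
  with pos show False by simp
qed

section \<open>Zonal harmonics\<close>

text \<open>
  A relation that carries the first and second derivatives as witnesses: unlike the total operator
  \<open>frechet_derivative\<close>, it passes to linear combinations without side conditions.
\<close>

definition has_laplacian :: "('e::euclidean_space \<Rightarrow> real) \<Rightarrow> ('e \<Rightarrow> real) \<Rightarrow> bool" where
  "has_laplacian f g \<longleftrightarrow> (\<exists>D E. (\<forall>x. (f has_derivative D x) (at x)) \<and>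
     (\<forall>b x. ((\<lambda>y. D y b) has_derivative E b x) (at x)) \<and> (\<forall>x. (\<Sum>b\<in>Basis. E b x b) = g x))"

lemma euclidean_laplacian_of_real:
  assumes "has_laplacian f g"
  shows "euclidean_laplacian (\<lambda>x. complex_of_real (f x)) x = of_real (g x)"
proof -
  obtain D E where D: "\<And>x. (f has_derivative D x) (at x)"
    and E: "\<And>b x. ((\<lambda>y. D y b) has_derivative E b x) (at x)"
    and g: "\<And>x. (\<Sum>b\<in>Basis. E b x b) = g x"
    using assms unfolding has_laplacian_def by blast
  have 1: "frechet_derivative (\<lambda>x. complex_of_real (f x)) (at y) = (\<lambda>b. of_real (D y b))" for y
    by (rule frechet_derivative_at[symmetric]) (intro has_derivative_of_real D)
  have 2: "frechet_derivative (\<lambda>y. complex_of_real (D y b)) (at x) = (\<lambda>w. of_real (E b x w))" for b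
    by (rule frechet_derivative_at[symmetric]) (intro has_derivative_of_real E)
  show ?thesis
    unfolding euclidean_laplacian_def 1 2 by (simp flip: g)
qed

lemma has_laplacian_sum:
  assumes "\<And>i. i \<in> I \<Longrightarrow> has_laplacian (f i) (g i)"
  shows "has_laplacian (\<lambda>x. \<Sum>i\<in>I. c i * f i x) (\<lambda>x. \<Sum>i\<in>I. c i * g i x)"
proof -
  have "\<forall>i\<in>I. \<exists>DE. (\<forall>x. (f i has_derivative fst DE x) (at x)) \<and>
     (\<forall>b x. ((\<lambda>y. fst DE y b) has_derivative snd DE b x) (at x)) \<and> (\<forall>x. (\<Sum>b\<in>Basis. snd DE b x b) = g i x)"
    using assms unfolding has_laplacian_def by simp
  then obtain DE where DE: "\<And>i x. i \<in> I \<Longrightarrow> (f i has_derivative fst (DE i) x) (at x)"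
      "\<And>i b x. i \<in> I \<Longrightarrow> ((\<lambda>y. fst (DE i) y b) has_derivative snd (DE i) b x) (at x)"
      "\<And>i x. i \<in> I \<Longrightarrow> (\<Sum>b\<in>Basis. snd (DE i) b x b) = g i x"
    unfolding bchoice_iff by blast
  show ?thesis unfolding has_laplacian_def
  proof (intro exI conjI allI)
    show "((\<lambda>x. \<Sum>i\<in>I. c i * f i x) has_derivative (\<lambda>b. \<Sum>i\<in>I. c i * fst (DE i) x b)) (at x)" for x
      by (intro has_derivative_sum has_derivative_mult_right DE)
    show "((\<lambda>y. \<Sum>i\<in>I. c i * fst (DE i) y b) has_derivative (\<lambda>w. \<Sum>i\<in>I. c i * snd (DE i) b x w)) (at x)" for b x
      by (intro has_derivative_sum has_derivative_mult_right DE)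
    show "(\<Sum>b\<in>Basis. \<Sum>i\<in>I. c i * snd (DE i) b x b) = (\<Sum>i\<in>I. c i * g i x)" for x
      by (subst sum.swap) (simp add: DE(3) flip: sum_distrib_left)
  qed
qed

definition zonal_term :: "'e::euclidean_space \<Rightarrow> nat \<Rightarrow> nat \<Rightarrow> 'e \<Rightarrow> real" where
  "zonal_term a k e x = (x \<bullet> x) ^ k * (x \<bullet> a) ^ e"

lemma zonal_term_has_derivative:
  "(zonal_term a k e has_derivative (\<lambda>b. 2 * real k * (x \<bullet> b) * zonal_term a (k - 1) e x + real e * (a \<bullet> b) * zonal_term a k (e - 1) x)) (at x)"
proof -
  have "((\<lambda>x. x \<bullet> x) has_derivative (\<lambda>b. 2 * (x \<bullet> b))) (at x)"
    using has_derivative_inner[OF has_derivative_ident has_derivative_ident, of x UNIV]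
    by (simp add: inner_commute)
  moreover have "((\<lambda>x. x \<bullet> a) has_derivative (\<lambda>b. a \<bullet> b)) (at x)"
    using bounded_linear_imp_has_derivative[OF bounded_linear_inner_left[of a], of "at x"]
    by (simp add: inner_commute)
  ultimately have "((\<lambda>x. (x \<bullet> x) ^ k * (x \<bullet> a) ^ e) has_derivative
      (\<lambda>b. (x \<bullet> x) ^ k * (of_nat e * (a \<bullet> b) * (x \<bullet> a) ^ (e - 1)) +
           of_nat k * (2 * (x \<bullet> b)) * (x \<bullet> x) ^ (k - 1) * (x \<bullet> a) ^ e)) (at x)"
    by (intro has_derivative_mult has_derivative_power)
  moreover have "zonal_term a k e = (\<lambda>x. (x \<bullet> x) ^ k * (x \<bullet> a) ^ e)"
    by (simp add: fun_eq_iff zonal_term_def)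
  moreover have "(x \<bullet> x) ^ k * (of_nat e * (a \<bullet> b) * (x \<bullet> a) ^ (e - 1)) +
           of_nat k * (2 * (x \<bullet> b)) * (x \<bullet> x) ^ (k - 1) * (x \<bullet> a) ^ e
      = 2 * real k * (x \<bullet> b) * zonal_term a (k - 1) e x + real e * (a \<bullet> b) * zonal_term a k (e - 1) x" for b
    by (simp only: zonal_term_def mult_ac add.commute)
  ultimately show ?thesis by (simp only:)
qed

lemma sum_inner_Basis: "(\<Sum>b\<in>Basis. (x \<bullet> b) * (y \<bullet> b)) = x \<bullet> (y :: 'e::euclidean_space)"
  by (rule euclidean_inner[symmetric])

text \<open>
  The functions \<open>|x|\<^sup>2\<^sup>k (x \<bullet> a)\<^sup>e\<close> are mapped by the Laplacian to combinations of two functions of the same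
  kind. This makes it possible to find harmonic combinations by a two-term recursion.
\<close>

lemma zonal_term_has_laplacian:
  fixes a :: "'e::euclidean_space"
  shows "has_laplacian (zonal_term a k e) (\<lambda>x. 2 * real k * (real DIM('e) + 2 * real k - 2 + 2 * real e) * zonal_term a (k - 1) e x
       + real e * real (e - 1) * (a \<bullet> a) * zonal_term a k (e - 2) x)"
  unfolding has_laplacian_def
proof (intro exI conjI allI)
  fix x :: 'e
  show "(zonal_term a k e has_derivative (\<lambda>b. 2 * real k * (x \<bullet> b) * zonal_term a (k - 1) e x + real e * (a \<bullet> b) * zonal_term a k (e - 1) x)) (at x)"
    by (rule zonal_term_has_derivative)
next
  fix b x :: 'e
  let ?d = "\<lambda>k e w. 2 * real k * (x \<bullet> w) * zonal_term a (k - 1) e x + real e * (a \<bullet> w) * zonal_term a k (e - 1) x"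
  show "((\<lambda>y. 2 * real k * (y \<bullet> b) * zonal_term a (k - 1) e y + real e * (a \<bullet> b) * zonal_term a k (e - 1) y) has_derivative
     (\<lambda>w. 2 * real k * ((x \<bullet> b) * ?d (k - 1) e w + (w \<bullet> b) * zonal_term a (k - 1) e x) + real e * (a \<bullet> b) * ?d k (e - 1) w)) (at x)"
    by (rule derivative_eq_intros zonal_term_has_derivative refl)+ (simp add: algebra_simps)
next
  fix x :: 'e
  let ?d = "\<lambda>k e w. 2 * real k * (x \<bullet> w) * zonal_term a (k - 1) e x + real e * (a \<bullet> w) * zonal_term a k (e - 1) x"
  \<comment> \<open>Where an exponent is truncated, the factor in front of the monomial is zero.\<close>
  have red: "real j * real (j - 1) * (x \<bullet> x) * zonal_term a (j - 1 - 1) i x = real j * (real j - 1) * zonal_term a (j - 1) i x"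
    for i j
    by (cases j; cases "j - 1") (simp_all add: zonal_term_def)
  have red': "real i * (x \<bullet> a) * zonal_term a j (i - 1) x = real i * zonal_term a j i x" for i j
    by (cases i) (simp_all add: zonal_term_def)
  have "(\<Sum>b\<in>Basis. 2 * real k * ((x \<bullet> b) * ?d (k - 1) e b + (b \<bullet> b) * zonal_term a (k - 1) e x) + real e * (a \<bullet> b) * ?d k (e - 1) b)
     = (\<Sum>b\<in>Basis. 4 * (real k * real (k - 1) * zonal_term a (k - 1 - 1) e x) * ((x \<bullet> b) * (x \<bullet> b))
          + 4 * (real k * (real e * zonal_term a (k - 1) (e - 1) x)) * ((x \<bullet> b) * (a \<bullet> b))
          + real e * real (e - 1) * zonal_term a k (e - 2) x * ((a \<bullet> b) * (a \<bullet> b))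
          + 2 * real k * zonal_term a (k - 1) e x)"
    by (rule sum.cong) (simp_all add: algebra_simps inner_same_Basis numeral_2_eq_2)
  also have "\<dots> = 4 * (real k * real (k - 1) * (x \<bullet> x) * zonal_term a (k - 1 - 1) e x)
          + 4 * (real k * (real e * (x \<bullet> a) * zonal_term a (k - 1) (e - 1) x))
          + real e * real (e - 1) * zonal_term a k (e - 2) x * (a \<bullet> a)
          + real DIM('e) * (2 * real k * zonal_term a (k - 1) e x)"
    by (simp add: sum.distrib sum_inner_Basis flip: sum_distrib_left)
  also have "\<dots> = 2 * real k * (real DIM('e) + 2 * real k - 2 + 2 * real e) * zonal_term a (k - 1) e x
       + real e * real (e - 1) * (a \<bullet> a) * zonal_term a k (e - 2) x"
    unfolding red red' by (simp add: algebra_simps)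
  finally show "(\<Sum>b\<in>Basis. 2 * real k * ((x \<bullet> b) * ?d (k - 1) e b + (b \<bullet> b) * zonal_term a (k - 1) e x) + real e * (a \<bullet> b) * ?d k (e - 1) b)
     = 2 * real k * (real DIM('e) + 2 * real k - 2 + 2 * real e) * zonal_term a (k - 1) e x
       + real e * real (e - 1) * (a \<bullet> a) * zonal_term a k (e - 2) x" .
qed

text \<open>
  The recursion is solved so that in the Laplacian of the sum below the first term of summand
  \<open>k + 1\<close> cancels the second term of summand \<open>k\<close>. For \<open>a \<noteq> 0\<close> in dimension at least
  three the sum is, up to a constant factor, a Gegenbauer polynomial in homogeneous form.
\<close>

primrec zonal_coeff :: "'e::euclidean_space \<Rightarrow> nat \<Rightarrow> nat \<Rightarrow> real" where
  "zonal_coeff a d 0 = 1"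
| "zonal_coeff a d (Suc k) = - zonal_coeff a d k * (real (d - 2 * k) * real (d - 2 * k - 1) * (a \<bullet> a))
     / (2 * (real k + 1) * (real DIM('e) + 2 * real k + 2 * real (d - 2 * k - 2)))"

lemma zonal_coeff_eq_0: "d < 2 * k \<Longrightarrow> zonal_coeff a d k = 0"
proof (induction k)
  case (Suc k)
  from Suc.prems have "d < 2 * k \<or> d - 2 * k = 0 \<or> d - 2 * k - 1 = 0" by arith
  then show ?case using Suc by auto
qed simp

definition zonal_harmonic :: "'e::euclidean_space \<Rightarrow> nat \<Rightarrow> 'e \<Rightarrow> real" where
  "zonal_harmonic a d x = (\<Sum>k\<le>d. zonal_coeff a d k * zonal_term a k (d - 2 * k) x)"

lemma real_polynomial_function_inner: "real_polynomial_function (\<lambda>x. x \<bullet> a)"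
  by (intro real_polynomial_function.intros(1) bounded_linear_inner_left)

lemma real_polynomial_function_inner_self: 
  "real_polynomial_function (\<lambda>x::'e::euclidean_space. x \<bullet> x)"
proof -
  have "real_polynomial_function (\<lambda>x::'e. \<Sum>b\<in>Basis. (x \<bullet> b) * (x \<bullet> b))"
    by (intro real_polynomial_function_sum real_polynomial_function.intros(4) real_polynomial_function_inner) auto
  then show ?thesis by (simp add: sum_inner_Basis)
qed

lemma real_polynomial_function_zonal_harmonic: "real_polynomial_function (zonal_harmonic a d)"
  unfolding zonal_harmonic_def zonal_term_def
  by (intro real_polynomial_function_sum real_polynomial_function.intros(2,4) real_polynomial_function_power
      real_polynomial_function_inner real_polynomial_function_inner_self) auto

lemma zonal_harmonic_scaleR: "zonal_harmonic a d (c *\<^sub>R x) = c ^ d * zonal_harmonic a d x"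
proof -
  have "zonal_coeff a d k * zonal_term a k (d - 2 * k) (c *\<^sub>R x) = c ^ d * (zonal_coeff a d k * zonal_term a k (d - 2 * k) x)" for k
  proof (cases "d < 2 * k")
    case False
    then have "c ^ d = c ^ (2 * k) * c ^ (d - 2 * k)" by (simp flip: power_add)
    then show ?thesis by (simp add: zonal_term_def power_mult_distrib power_mult power2_eq_square mult_ac)
  qed (simp add: zonal_coeff_eq_0)
  then show ?thesis unfolding zonal_harmonic_def sum_distrib_left by (intro sum.cong refl)
qed

lemma has_laplacian_zonal_harmonic: "has_laplacian (zonal_harmonic (a :: 'e::euclidean_space) d) (\<lambda>x. 0)"
proof -
  let ?c = "zonal_coeff a d"
  let ?N = "real DIM('e)"
  define T where "T x k = ?c k * (2 * real k * (?N + 2 * real k - 2 + 2 * real (d - 2 * k)) * zonal_term a (k - 1) (d - 2 * k) x)" for x k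
  define U where "U x k = ?c k * (real (d - 2 * k) * real (d - 2 * k - 1) * (a \<bullet> a) * zonal_term a k (d - 2 * k - 2) x)" for x k
  have TU: "T x (Suc k) = - U x k" for x k
  proof -
    define M where "M = 2 * (real k + 1) * (?N + 2 * real k + 2 * real (d - 2 * k - 2))"
    have "?N + 2 * real k + 2 * real (d - 2 * k - 2) > 0"
      using DIM_positive[where 'a = 'e] by (intro add_pos_nonneg) auto
    then have "M \<noteq> 0" by (simp add: M_def)
    moreover have "?c (Suc k) = - ?c k * (real (d - 2 * k) * real (d - 2 * k - 1) * (a \<bullet> a)) / M"
      by (simp only: zonal_coeff.simps M_def)
    ultimately have c: "?c (Suc k) * M = - ?c k * (real (d - 2 * k) * real (d - 2 * k - 1) * (a \<bullet> a))"
      by (simp del: zonal_coeff.simps)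
    have "T x (Suc k) = (?c (Suc k) * M) * zonal_term a k (d - 2 * k - 2) x"
    proof -
      have "2 * real (Suc k) * (?N + 2 * real (Suc k) - 2 + 2 * real (d - 2 * Suc k)) = M"
        by (simp add: M_def algebra_simps)
      moreover have "d - 2 * Suc k = d - 2 * k - 2" by simp
      ultimately show ?thesis unfolding T_def by (simp only: mult.assoc diff_Suc_1)
    qed
    then show ?thesis unfolding c by (simp add: U_def)
  qed
  have "(\<Sum>k\<le>d. T x k + U x k) = 0" for x
  proof -
    have "(\<Sum>k\<le>d. T x k) = (\<Sum>k<d. - U x k)"
      unfolding sum.atMost_shift TU by (simp add: T_def)
    moreover have "(\<Sum>k\<le>d. U x k) = (\<Sum>k<d. U x k)"
      by (simp add: lessThan_Suc_atMost[symmetric] U_def)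
    ultimately show ?thesis by (simp add: sum.distrib sum_negf)
  qed
  moreover have "has_laplacian (zonal_harmonic a d) (\<lambda>x. \<Sum>k\<le>d. T x k + U x k)"
    unfolding zonal_harmonic_def T_def U_def distrib_left[symmetric]
    by (intro has_laplacian_sum zonal_term_has_laplacian)
  ultimately show ?thesis by simp
qed

lemma spherical_harmonic_zonal:
  assumes "\<And>x. x \<in> sphere 0 1 \<Longrightarrow> Y x = complex_of_real (r * zonal_harmonic a d x)"
  shows "spherical_harmonic d Y"
  unfolding spherical_harmonic_def
proof (intro exI conjI allI ballI)
  show "polynomial_function (\<lambda>x. complex_of_real (r * zonal_harmonic a d x))"
    unfolding polynomial_function_def
  proof (intro allI impI)
    fix f :: "complex \<Rightarrow> real" assume "bounded_linear f"
    then have "f (of_real t) = t * f 1" for t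
      using linear_scale[OF bounded_linear.linear, of f t 1] by (simp add: scaleR_conv_of_real)
    then have "f \<circ> (\<lambda>x. complex_of_real (r * zonal_harmonic a d x)) = (\<lambda>x. r * zonal_harmonic a d x * f 1)"
      by (simp add: fun_eq_iff del: of_real_mult)
    moreover have "real_polynomial_function (\<lambda>x. r * zonal_harmonic a d x * f 1)"
      by (intro real_polynomial_function.intros(2,4) real_polynomial_function_zonal_harmonic)
    ultimately show "real_polynomial_function (f \<circ> (\<lambda>x. complex_of_real (r * zonal_harmonic a d x)))"
      by (simp only:)
  qed
  have "has_laplacian (\<lambda>x. r * zonal_harmonic a d x) (\<lambda>x. 0)"
    using has_laplacian_sum[of "{()}" "\<lambda>_. zonal_harmonic a d" "\<lambda>_ _. 0" "\<lambda>_. r"] has_laplacian_zonal_harmonic[of a d]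
    by simp
  then show "euclidean_laplacian (\<lambda>x. complex_of_real (r * zonal_harmonic a d x)) x = 0" for x
    by (simp only: euclidean_laplacian_of_real of_real_0)
qed (simp_all add: assms zonal_harmonic_scaleR scaleR_conv_of_real)

text \<open>
  On the sphere \<open>|x|\<^sup>2 = 1\<close>, so the terms of a zonal harmonic after the first are multiples of powers of \<open>x \<bullet> a\<close> of
  lower degree. By induction on \<open>d\<close>, all powers of \<open>x \<bullet> a\<close> are combinations of zonal harmonics there.
\<close>

lemma power_inner_on_sphere:
  assumes "x \<in> sphere 0 1"
  shows "(x \<bullet> a) ^ d = zonal_harmonic a d x - (\<Sum>k=1..d. zonal_coeff a d k * (x \<bullet> a) ^ (d - 2 * k))"
proof -
  have "x \<bullet> x = 1" using assms by (simp add: norm_eq_1[symmetric])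
  then have "zonal_harmonic a d x = (\<Sum>k\<le>d. zonal_coeff a d k * (x \<bullet> a) ^ (d - 2 * k))"
    by (simp add: zonal_harmonic_def zonal_term_def)
  also have "\<dots> = (x \<bullet> a) ^ d + (\<Sum>k=1..d. zonal_coeff a d k * (x \<bullet> a) ^ (d - 2 * k))"
    by (simp add: atMost_atLeast0 sum.atLeast_Suc_atMost)
  finally show ?thesis by simp
qed

section \<open>Completeness of products of zonal harmonics\<close>

definition annihilates :: "('a::euclidean_space \<times> 'b::euclidean_space \<Rightarrow> complex) \<Rightarrow> ('a \<times> 'b \<Rightarrow> real) \<Rightarrow> bool" where
  "annihilates h g \<longleftrightarrow> (\<integral>z. h z * complex_of_real (g z) \<partial>(sphere_measure \<Otimes>\<^sub>M sphere_measure)) = 0"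

context
  fixes h :: "'a::euclidean_space \<times> 'b::euclidean_space \<Rightarrow> complex"
  assumes h: "h \<in> smooth_fns"
begin

lemma integrable_mult_of_real:
  assumes "continuous_on sphere_prod g"
  shows "integrable (sphere_measure \<Otimes>\<^sub>M sphere_measure) (\<lambda>z. h z * complex_of_real (g z))"
  by (rule integrable_product)
    (auto intro!: continuous_intros assms smooth_fns_continuous_on[OF h] simp: smooth_fns_vanish[OF h])

lemma annihilates_cong:
  assumes "\<And>z. z \<in> sphere_prod \<Longrightarrow> g z = g' z"
  shows "annihilates h g \<longleftrightarrow> annihilates h g'"
proof -
  have "(\<lambda>z. h z * complex_of_real (g z)) = (\<lambda>z. h z * complex_of_real (g' z))"
    using assms smooth_fns_vanish[OF h] by (metis mult_zero_left)
  then show ?thesis by (simp only: annihilates_def)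
qed

lemma annihilates_cmult: "annihilates h g \<Longrightarrow> annihilates h (\<lambda>z. c * g z)"
  by (simp add: annihilates_def mult.left_commute)

lemma annihilates_add:
  assumes "continuous_on sphere_prod g" "continuous_on sphere_prod g'" "annihilates h g" "annihilates h g'"
  shows "annihilates h (\<lambda>z. g z + g' z)"
  using assms by (simp add: annihilates_def distrib_left integrable_mult_of_real)

lemma annihilates_sum:
  assumes "\<And>i. i \<in> I \<Longrightarrow> continuous_on sphere_prod (g i)" "\<And>i. i \<in> I \<Longrightarrow> annihilates h (g i)"
  shows "annihilates h (\<lambda>z. \<Sum>i\<in>I. g i z)"
  using assms by (simp add: annihilates_def sum_distrib_left integrable_mult_of_real)

text \<open>
  The integral against \<open>h\<close> is bounded by the integral of \<open>|h|\<close> times the uniform norm.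
\<close>

lemma annihilates_limit:
  assumes g: "continuous_on sphere_prod g"
    and approx: "\<And>e. e > 0 \<Longrightarrow> \<exists>g'. continuous_on sphere_prod g' \<and> annihilates h g' \<and> (\<forall>z\<in>sphere_prod. \<bar>g z - g' z\<bar> < e)"
  shows "annihilates h g"
proof (rule ccontr)
  let ?M = "sphere_measure \<Otimes>\<^sub>M sphere_measure :: ('a \<times> 'b) measure"
  define K where "K = (\<integral>z. norm (h z) \<partial>?M)"
  define L where "L = norm (\<integral>z. h z * complex_of_real (g z) \<partial>?M)"
  assume "\<not> annihilates h g"
  then have L: "L > 0" by (simp add: L_def annihilates_def)
  have K: "K \<ge> 0" by (simp add: K_def)
  have hint: "integrable ?M (\<lambda>z. norm (h z))"
    using integrable_mult_of_real[of "\<lambda>_. 1"] by (intro integrable_norm) simp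
  from approx[of "L / (K + 1)"] L K obtain g' where g': "continuous_on sphere_prod g'" "annihilates h g'"
    and close: "\<And>z. z \<in> sphere_prod \<Longrightarrow> \<bar>g z - g' z\<bar> < L / (K + 1)" by auto
  have "L = norm (\<integral>z. h z * complex_of_real (g z - g' z) \<partial>?M)"
    using g'(2) g g'(1)
    by (simp add: L_def annihilates_def right_diff_distrib integrable_mult_of_real)
  also have "\<dots> \<le> (\<integral>z. norm (h z * complex_of_real (g z - g' z)) \<partial>?M)"
    by (rule integral_norm_bound)
  also have "\<dots> \<le> (\<integral>z. L / (K + 1) * norm (h z) \<partial>?M)"
  proof (rule integral_mono)
    show "integrable ?M (\<lambda>z. norm (h z * complex_of_real (g z - g' z)))"
      by (intro integrable_norm integrable_mult_of_real continuous_intros g g')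
    show "integrable ?M (\<lambda>z. L / (K + 1) * norm (h z))"
      using hint by simp
    show "norm (h z * complex_of_real (g z - g' z)) \<le> L / (K + 1) * norm (h z)" for z
    proof (cases "z \<in> sphere_prod")
      case True
      then show ?thesis
        using mult_right_mono[OF less_imp_le[OF close[OF True]] norm_ge_zero[of "h z"]]
        by (simp only: norm_mult norm_of_real mult.commute)
    qed (simp add: smooth_fns_vanish[OF h])
  qed
  also have "\<dots> = L * (K / (K + 1))" by (simp add: K_def)
  also have "\<dots> < L * 1" using L K by (intro mult_strict_left_mono) auto
  finally show False by simp
qed

context
  assumes zonal: "\<And>a b d e. annihilates h (\<lambda>(x, y). zonal_harmonic a d x * zonal_harmonic b e y)"
begin

lemma continuous_on_zonal_harmonic [continuous_intros]:
  "continuous_on S f \<Longrightarrow> continuous_on S (\<lambda>z. zonal_harmonic a d (f z))"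
  unfolding zonal_harmonic_def zonal_term_def by (intro continuous_intros)

lemma annihilates_power_zonal:
  "annihilates h (\<lambda>(x, y). (x \<bullet> a) ^ d * zonal_harmonic b e y)"
proof (induction d rule: less_induct)
  case (less d)
  let ?t = "\<lambda>k z. (- zonal_coeff a d k) * (case z of (x, y) \<Rightarrow> (x \<bullet> a) ^ (d - 2 * k) * zonal_harmonic b e y)"
  have "annihilates h (\<lambda>z. \<Sum>k=1..d. ?t k z)"
    by (intro annihilates_sum annihilates_cmult less) (auto intro!: continuous_intros simp: case_prod_unfold)
  then have "annihilates h (\<lambda>z. (case z of (x, y) \<Rightarrow> zonal_harmonic a d x * zonal_harmonic b e y) + (\<Sum>k=1..d. ?t k z))"
    by (intro annihilates_add zonal) (auto intro!: continuous_intros simp: case_prod_unfold)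
  then show ?case
  proof (rule iffD1[OF annihilates_cong, rotated])
    fix z :: "'a \<times> 'b" assume "z \<in> sphere_prod"
    then have "fst z \<in> sphere 0 1" by (auto simp: sphere_prod_def)
    from power_inner_on_sphere[OF this, of a d]
    show "(case z of (x, y) \<Rightarrow> zonal_harmonic a d x * zonal_harmonic b e y) + (\<Sum>k=1..d. ?t k z)
       = (case z of (x, y) \<Rightarrow> (x \<bullet> a) ^ d * zonal_harmonic b e y)"
      by (simp add: case_prod_unfold left_diff_distrib sum_distrib_right sum_negf mult.assoc)
  qed
qed

lemma annihilates_power_power:
  "annihilates h (\<lambda>(x, y). (x \<bullet> a) ^ d * (y \<bullet> b) ^ e)"
proof (induction e rule: less_induct)
  case (less e)
  let ?t = "\<lambda>k z. (- zonal_coeff b e k) * (case z of (x, y) \<Rightarrow> (x \<bullet> a) ^ d * (y \<bullet> b) ^ (e - 2 * k))"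
  have "annihilates h (\<lambda>z. \<Sum>k=1..e. ?t k z)"
    by (intro annihilates_sum annihilates_cmult less) (auto intro!: continuous_intros simp: case_prod_unfold)
  then have "annihilates h (\<lambda>z. (case z of (x, y) \<Rightarrow> (x \<bullet> a) ^ d * zonal_harmonic b e y) + (\<Sum>k=1..e. ?t k z))"
    by (intro annihilates_add annihilates_power_zonal) (auto intro!: continuous_intros simp: case_prod_unfold)
  then show ?case
  proof (rule iffD1[OF annihilates_cong, rotated])
    fix z :: "'a \<times> 'b" assume "z \<in> sphere_prod"
    then have "snd z \<in> sphere 0 1" by (auto simp: sphere_prod_def)
    from power_inner_on_sphere[OF this, of b e]
    show "(case z of (x, y) \<Rightarrow> (x \<bullet> a) ^ d * zonal_harmonic b e y) + (\<Sum>k=1..e. ?t k z)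
       = (case z of (x, y) \<Rightarrow> (x \<bullet> a) ^ d * (y \<bullet> b) ^ e)"
      by (simp add: case_prod_unfold right_diff_distrib sum_distrib_left sum_negf mult_ac)
  qed
qed

text \<open>
  By the binomial theorem, a power of a linear form on the product space splits into products of powers of
  linear forms on the factors.
\<close>

lemma annihilates_power_inner: "annihilates h (\<lambda>z. (z \<bullet> c) ^ n)"
proof -
  obtain a b where c: "c = (a, b)" by (cases c)
  have "annihilates h (\<lambda>z. \<Sum>i\<le>n. of_nat (n choose i) * (case z of (x, y) \<Rightarrow> (x \<bullet> a) ^ i * (y \<bullet> b) ^ (n - i)))"
    by (intro annihilates_sum annihilates_cmult annihilates_power_power)
      (auto intro!: continuous_intros simp: case_prod_unfold)
  moreover have "(\<lambda>z. \<Sum>i\<le>n. of_nat (n choose i) * (case z of (x, y) \<Rightarrow> (x \<bullet> a) ^ i * (y \<bullet> b) ^ (n - i))) = (\<lambda>z. (z \<bullet> c) ^ n)"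
    by (simp add: c fun_eq_iff binomial_ring mult.assoc)
  ultimately show ?thesis by simp
qed

lemma annihilates_exp_inner: "annihilates h (\<lambda>z. exp (z \<bullet> c))"
proof (rule annihilates_limit)
  show "continuous_on sphere_prod (\<lambda>z::'a \<times> 'b. exp (z \<bullet> c))" by (intro continuous_intros)
  obtain R where R: "\<And>z::'a \<times> 'b. z \<in> sphere_prod \<Longrightarrow> norm z \<le> R"
    using compact_imp_bounded[OF compact_sphere_prod] by (auto simp: bounded_iff)
  have "uniform_limit (sphere_prod :: ('a \<times> 'b) set) (\<lambda>n z. \<Sum>i<n. (z \<bullet> c) ^ i /\<^sub>R fact i)
      (\<lambda>z. \<Sum>i. (z \<bullet> c) ^ i /\<^sub>R fact i) sequentially"
  proof (rule Weierstrass_m_test)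
    show "norm ((z \<bullet> c) ^ i /\<^sub>R fact i) \<le> (R * norm c) ^ i /\<^sub>R fact i" if "z \<in> sphere_prod" for i z
    proof -
      have "\<bar>z \<bullet> c\<bar> \<le> R * norm c"
        using Cauchy_Schwarz_ineq2[of z c] mult_right_mono[OF R[OF that] norm_ge_zero[of c]] by linarith
      then have "\<bar>z \<bullet> c\<bar> ^ i \<le> (R * norm c) ^ i" by (intro power_mono) auto
      then show ?thesis by (simp add: abs_mult power_abs mult_left_mono)
    qed
    show "summable (\<lambda>i. (R * norm c) ^ i /\<^sub>R fact i)"
      by (rule summable_exp_generic)
  qed
  then have unif: "uniform_limit sphere_prod (\<lambda>n z. \<Sum>i<n. (z \<bullet> c) ^ i /\<^sub>R fact i) (\<lambda>z. exp (z \<bullet> c)) sequentially"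
    by (simp add: exp_def)
  fix e :: real assume "e > 0"
  from uniform_limitD[OF unif this] obtain n where
    n: "\<And>z. z \<in> sphere_prod \<Longrightarrow> dist (\<Sum>i<n. (z \<bullet> c) ^ i /\<^sub>R fact i) (exp (z \<bullet> c)) < e"
    by (auto simp: eventually_sequentially)
  have "annihilates h (\<lambda>z. \<Sum>i<n. inverse (fact i) * (z \<bullet> c) ^ i)"
    by (intro annihilates_sum annihilates_cmult annihilates_power_inner continuous_intros)
  then show "\<exists>g'. continuous_on sphere_prod g' \<and> annihilates h g' \<and> (\<forall>z\<in>sphere_prod. \<bar>exp (z \<bullet> c) - g' z\<bar> < e)"
    using n
    by (intro exI[of _ "\<lambda>z. \<Sum>i<n. inverse (fact i) * (z \<bullet> c) ^ i"] conjI)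
      (auto intro!: continuous_intros simp: dist_real_def abs_minus_commute)
qed

end
end

text \<open>
  Exponentials of linear forms are used in place of polynomials because their span is visibly closed under
  products: powers of linear forms would need a polarization argument.
\<close>

inductive exp_comb :: "('e::euclidean_space \<Rightarrow> real) \<Rightarrow> bool" where
  exp: "exp_comb (\<lambda>z. r * exp (z \<bullet> c))"
| add: "exp_comb f \<Longrightarrow> exp_comb g \<Longrightarrow> exp_comb (\<lambda>z. f z + g z)"

lemma exp_comb_continuous_on: "exp_comb f \<Longrightarrow> continuous_on S f"
  by (induction rule: exp_comb.induct) (auto intro!: continuous_intros)

lemma exp_comb_mult: "exp_comb f \<Longrightarrow> exp_comb g \<Longrightarrow> exp_comb (\<lambda>z. f z * g z)"
proof (induction rule: exp_comb.induct)
  case (exp r c)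
  from exp show ?case
  proof (induction rule: exp_comb.induct)
    case (exp r' c')
    have "exp_comb (\<lambda>z. (r * r') * exp (z \<bullet> (c + c')))" by (rule exp_comb.exp)
    then show ?case by (simp add: inner_add_right exp_add mult_ac)
  qed (simp add: distrib_left exp_comb.add)
qed (simp add: distrib_right exp_comb.add)

text \<open>
  Completeness of the products of zonal harmonics: they generate the powers of linear forms, hence their
  exponential series, hence a dense algebra of continuous functions, so \<open>h\<close> is orthogonal to its own real and
  imaginary parts.
\<close>

theorem smooth_fn_eq_0_if_annihilates_zonal:
  fixes h :: "'a::euclidean_space \<times> 'b::euclidean_space \<Rightarrow> complex"
  assumes h: "h \<in> smooth_fns"
    and zonal: "\<And>a b d e. annihilates h (\<lambda>(x, y). zonal_harmonic a d x * zonal_harmonic b e y)"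
  shows "h = 0"
proof -
  have comb: "annihilates h f" if "exp_comb f" for f
    using that
    by induction (auto intro!: annihilates_cmult[OF h] annihilates_exp_inner[OF h zonal]
        annihilates_add[OF h] exp_comb_continuous_on)
  have all: "annihilates h g" if g: "continuous_on sphere_prod g" for g
  proof (rule annihilates_limit[OF h g])
    fix e :: real assume "e > 0"
    have "\<exists>g'. exp_comb g' \<and> (\<forall>z\<in>sphere_prod. \<bar>g z - g' z\<bar> < e)"
    proof (rule Stone_Weierstrass_HOL[OF compact_sphere_prod])
      show "exp_comb (\<lambda>z. r)" for r
        using exp_comb.exp[of r 0] by simp
      show "\<exists>f. exp_comb f \<and> f x \<noteq> f y" if "x \<in> sphere_prod \<and> y \<in> sphere_prod \<and> x \<noteq> y" for x y :: "'a \<times> 'b"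
      proof -
        have "x \<bullet> (x - y) \<noteq> y \<bullet> (x - y)" using that by (metis inner_diff_left inner_eq_zero_iff right_minus_eq)
        then show ?thesis
          using exp_comb.exp[of 1 "x - y"] by (intro exI[of _ "\<lambda>z. 1 * exp (z \<bullet> (x - y))"]) auto
      qed
    qed (auto intro: exp_comb_continuous_on exp_comb.add exp_comb_mult g \<open>e > 0\<close>)
    then show "\<exists>g'. continuous_on sphere_prod g' \<and> annihilates h g' \<and> (\<forall>z\<in>sphere_prod. \<bar>g z - g' z\<bar> < e)"
      using comb exp_comb_continuous_on by blast
  qed
  have Re: "continuous_on sphere_prod (\<lambda>z. Re (h z))" and Im: "continuous_on sphere_prod (\<lambda>z. Im (h z))"
    by (intro continuous_intros smooth_fns_continuous_on[OF h])+
  have "h z * cnj (h z) = h z * complex_of_real (Re (h z)) - \<i> * (h z * complex_of_real (Im (h z)))" for z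
    by (simp add: complex_eq_iff)
  then have "l2_inner h h = 0"
    using all[OF Re] all[OF Im]
    by (simp add: l2_inner_def annihilates_def integrable_mult_of_real[OF h Re] integrable_mult_of_real[OF h Im])
  then show ?thesis by (rule l2_inner_self_eq_0D[OF h])
qed

definition zonal_product :: "'a::euclidean_space \<Rightarrow> nat \<Rightarrow> 'b::euclidean_space \<Rightarrow> nat \<Rightarrow> 'a \<times> 'b \<Rightarrow> complex" where
  "zonal_product a d b e = (\<lambda>z. if z \<in> sphere_prod
     then complex_of_real (zonal_harmonic a d (fst z) * zonal_harmonic b e (snd z)) else 0)"

lemma real_polynomial_function_comp_linear:
  assumes "real_polynomial_function f" "bounded_linear l"
  shows "real_polynomial_function (\<lambda>z. f (l z))"
  using assms(1)
proof induction
  case (linear f)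
  show ?case
    by (rule real_polynomial_function.intros(1)[OF bounded_linear_compose[OF linear assms(2)]])
qed (simp_all add: real_polynomial_function.intros(2-4))

lemma zonal_product_smooth: "zonal_product a d b e \<in> smooth_fns"
  unfolding zonal_product_def
  by (intro smooth_fns_polynomial real_polynomial_function.intros(4) bounded_linear_fst bounded_linear_snd
      real_polynomial_function_comp_linear[OF real_polynomial_function_zonal_harmonic])

lemma spherical_harmonic_zonal_product:
  "y \<in> sphere 0 1 \<Longrightarrow> spherical_harmonic d (\<lambda>x. zonal_product a d b e (x, y))"
  "x \<in> sphere 0 1 \<Longrightarrow> spherical_harmonic e (\<lambda>y. zonal_product a d b e (x, y))"
proof -
  show "spherical_harmonic d (\<lambda>x. zonal_product a d b e (x, y))" if "y \<in> sphere 0 1"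
    by (rule spherical_harmonic_zonal[of _ "zonal_harmonic b e y" a])
      (use that in \<open>simp add: zonal_product_def sphere_prod_def mult.commute\<close>)
  show "spherical_harmonic e (\<lambda>y. zonal_product a d b e (x, y))" if "x \<in> sphere 0 1"
    by (rule spherical_harmonic_zonal[of _ "zonal_harmonic a d x" b])
      (use that in \<open>simp add: zonal_product_def sphere_prod_def\<close>)
qed

text \<open>
  The products of zonal harmonics are common eigenfunctions. By symmetry, the inner products of \<open>B (C f)\<close> and
  of \<open>C (B f)\<close> with such an eigenfunction are the same multiple of that of \<open>f\<close>, and completeness gives equality. The
  spectral theorem on a Hilbert space is avoided: the smooth functions form only a pre-Hilbert space.
\<close>

theorem symmetric_operators_commute:
  fixes B C :: "('a::euclidean_space, 'b::euclidean_space) operator"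
  assumes B: "\<And>f. f \<in> smooth_fns \<Longrightarrow> B f \<in> smooth_fns" and C: "\<And>f. f \<in> smooth_fns \<Longrightarrow> C f \<in> smooth_fns"
    and B_sym: "\<And>f g. f \<in> smooth_fns \<Longrightarrow> g \<in> smooth_fns \<Longrightarrow> l2_inner (B f) g = l2_inner f (B g)"
    and C_sym: "\<And>f g. f \<in> smooth_fns \<Longrightarrow> g \<in> smooth_fns \<Longrightarrow> l2_inner (C f) g = l2_inner f (C g)"
    and B_eig: "\<And>a d b e. B (zonal_product a d b e) = scalar_op (\<beta> d) (zonal_product a d b e)"
    and C_eig: "\<And>a d b e. C (zonal_product a d b e) = scalar_op (\<gamma> e) (zonal_product a d b e)"
    and f: "f \<in> smooth_fns"
  shows "B (C f) = C (B f)"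
proof -
  define h where "h = B (C f) + scalar_op (-1) (C (B f))"
  have BC: "B (C f) \<in> smooth_fns" and CB: "C (B f) \<in> smooth_fns" using f B C by auto
  then have h: "h \<in> smooth_fns" unfolding h_def by (intro smooth_fns_add smooth_fns_scalar_op)
  have "annihilates h (\<lambda>(x, y). zonal_harmonic a d x * zonal_harmonic b e y)" for a b d e
  proof -
    let ?g = "zonal_product a d b e"
    let ?u = "\<lambda>z. zonal_harmonic a d (fst z) * zonal_harmonic b e (snd z)"
    have u: "continuous_on sphere_prod ?u" 
      unfolding zonal_harmonic_def zonal_term_def by (intro continuous_intros)
    have g: "?g \<in> smooth_fns" by (rule zonal_product_smooth)
    have l2: "l2_inner k ?g = (\<integral>z. k z * complex_of_real (?u z) \<partial>(sphere_measure \<Otimes>\<^sub>M sphere_measure))"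
      if k: "k \<in> smooth_fns" for k
    proof -
      have "k z * cnj (?g z) = k z * complex_of_real (?u z)" for z
        by (cases "z \<in> sphere_prod") (simp_all add: zonal_product_def smooth_fns_vanish[OF k])
      then show ?thesis by (simp only: l2_inner_def)
    qed
    have sc: "l2_inner k (scalar_op c ?g) = cnj c * l2_inner k ?g" for k c
      by (simp add: l2_inner_def scalar_op_def mult.left_commute)
    have "l2_inner (B (C f)) ?g = l2_inner (C (B f)) ?g"
      by (simp add: B_sym C_sym B_eig C_eig sc f g B C)
    then have "(\<integral>z. h z * complex_of_real (?u z) \<partial>(sphere_measure \<Otimes>\<^sub>M sphere_measure)) = 0"
      using integrable_mult_of_real[OF BC u] integrable_mult_of_real[OF CB u]
      by (simp add: l2[OF BC] l2[OF CB] h_def scalar_op_def left_diff_distrib)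
    then show ?thesis by (simp add: annihilates_def case_prod_unfold)
  qed
  then have "h = 0" by (rule smooth_fn_eq_0_if_annihilates_zonal[OF h])
  then show ?thesis by (simp add: h_def scalar_op_def fun_eq_iff)
qed

section \<open>The product formula for the operators\<close>

lemma module_on_smooth_fns: "module_on smooth_fns scalar_op"
  by unfold_locales
    (simp_all add: zero_in_smooth_fns smooth_fns_add smooth_fns_scalar_op, simp_all add: scalar_op_def fun_eq_iff algebra_simps)

lemma nonneg_sqrt_endo:
  assumes "nonneg_sqrt T R"
  shows "module_on.endo smooth_fns scalar_op R"
proof -
  interpret module_on smooth_fns scalar_op by (rule module_on_smooth_fns)
  have lin: "R (scalar_op a f + scalar_op b g) = scalar_op a (R f) + scalar_op b (R g)"
    if "f \<in> smooth_fns" "g \<in> smooth_fns" for f g a b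
    using assms that by (simp add: nonneg_sqrt_def)
  have mem: "R f \<in> smooth_fns" if "f \<in> smooth_fns" for f
    using assms that by (simp add: nonneg_sqrt_def)
  show ?thesis
    unfolding endo_def
  proof (intro conjI ballI allI)
    show "R (f + g) = R f + R g" if "f \<in> smooth_fns" "g \<in> smooth_fns" for f g
      using lin[OF that, of 1 1] by (simp add: smul_one that mem)
    show "R (scalar_op a f) = scalar_op a (R f)" if "f \<in> smooth_fns" for f a
      using lin[OF that that, of a 0] by (simp add: smul_zero_left that mem)
  qed (rule mem)
qed

theorem proposition1:
  fixes p q m n :: nat
    and B C :: "('a::euclidean_space, 'b::euclidean_space) operator"
    and u v P Q :: complex
  assumes "p \<ge> 1" and "q \<ge> 1" and "m \<ge> 1" and "n = p + q"
    and "DIM('a) = p + 1" and "DIM('b) = q + 1"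
    and C_sqrt: "nonneg_sqrt (laplacian_snd + scalar_op (((of_nat q - 1) / 2)\<^sup>2)) C"
    and C_spectral: "\<And>j f. f \<in> smooth_fns \<Longrightarrow>
          (\<forall>x\<in>sphere 0 1. spherical_harmonic j (\<lambda>y. f (x, y))) \<Longrightarrow>
          C f = scalar_op (of_nat j + (of_nat q - 1) / 2) f"
    and B_sqrt: "nonneg_sqrt (laplacian_fst + scalar_op (((of_nat p - 1) / 2)\<^sup>2)) B"
    and B_spectral: "\<And>k f. f \<in> smooth_fns \<Longrightarrow>
          (\<forall>y\<in>sphere 0 1. spherical_harmonic k (\<lambda>x. f (x, y))) \<Longrightarrow>
          B f = scalar_op (of_nat k + (of_nat p - 1) / 2) f"
    and "u + v = of_nat m - of_nat n / 2"
    and "Q = (of_nat q - 1) / 2 + v" and "P = (of_nat p - 1) / 2 + u"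
  shows "P + Q = of_nat m - 1 \<and>
    (\<forall>f\<in>smooth_fns. A_op m C B P Q f =
       (op_prod (\<lambda>i. C + B + scalar_op (of_nat m - 1 - 2 * of_nat i)) m \<circ>
        op_prod (\<lambda>i. C - B + scalar_op (of_nat m - 1 - 2 * of_nat i)) m) f) \<and>
    (\<forall>u' v' P' Q'. u' + v' = of_nat m - of_nat n / 2 \<longrightarrow>
       Q' = (of_nat q - 1) / 2 + v' \<longrightarrow> P' = (of_nat p - 1) / 2 + u' \<longrightarrow>
       (\<forall>f\<in>smooth_fns. A_op m C B P' Q' f = A_op m C B P Q f))"
proof -
  have V: "module_on smooth_fns scalar_op"
    by (rule module_on_smooth_fns)
  have B_mem: "B f \<in> smooth_fns" and C_mem: "C f \<in> smooth_fns" if "f \<in> smooth_fns" for f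
    using B_sqrt C_sqrt that by (simp_all add: nonneg_sqrt_def)
  have B_sym: "l2_inner (B f) g = l2_inner f (B g)" and C_sym: "l2_inner (C f) g = l2_inner f (C g)"
    if "f \<in> smooth_fns" "g \<in> smooth_fns" for f g
    using B_sqrt C_sqrt that by (simp_all add: nonneg_sqrt_def)
  have B_eig: "B (zonal_product a d b e) = scalar_op (of_nat d + (of_nat p - 1) / 2) (zonal_product a d b e)"
    for a :: 'a and b :: 'b and d e
    by (intro B_spectral zonal_product_smooth ballI spherical_harmonic_zonal_product)
  have C_eig: "C (zonal_product a d b e) = scalar_op (of_nat e + (of_nat q - 1) / 2) (zonal_product a d b e)"
    for a :: 'a and b :: 'b and d e
    by (intro C_spectral zonal_product_smooth ballI spherical_harmonic_zonal_product)
  have BC: "B (C f) = C (B f)" if "f \<in> smooth_fns" for f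
    by (rule symmetric_operators_commute[OF B_mem C_mem B_sym C_sym B_eig C_eig that])
  have sum_eq: "P' + Q' = of_nat m - 1"
    if "u' + v' = of_nat m - of_nat n / 2" "Q' = (of_nat q - 1) / 2 + v'" "P' = (of_nat p - 1) / 2 + u'"
    for u' v' P' Q' :: complex
  proof -
    have "P' + Q' = (u' + v') + of_nat n / 2 - 1"
      by (simp add: that(2,3) \<open>n = p + q\<close> field_simps)
    then show ?thesis by (simp add: that(1))
  qed
  have product: "A_op m C B P' Q' f =
       (op_prod (\<lambda>i. C + B + scalar_op (of_nat m - 1 - 2 * of_nat i)) m \<circ>
        op_prod (\<lambda>i. C - B + scalar_op (of_nat m - 1 - 2 * of_nat i)) m) f"
    if "P' + Q' = of_nat m - 1" "f \<in> smooth_fns" for P' Q' f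
    using V nonneg_sqrt_endo[OF B_sqrt] nonneg_sqrt_endo[OF C_sqrt] BC that by (rule A_op_eq_prod)
  have PQ: "P + Q = of_nat m - 1"
    by (rule sum_eq) fact+
  show ?thesis
  proof (intro conjI allI impI ballI)
    show "P + Q = of_nat m - 1" by (rule PQ)
    show "A_op m C B P Q f =
       (op_prod (\<lambda>i. C + B + scalar_op (of_nat m - 1 - 2 * of_nat i)) m \<circ>
        op_prod (\<lambda>i. C - B + scalar_op (of_nat m - 1 - 2 * of_nat i)) m) f"
      if "f \<in> smooth_fns" for f
      by (rule product[OF PQ that])
    show "A_op m C B P' Q' f = A_op m C B P Q f"
      if "u' + v' = of_nat m - of_nat n / 2" "Q' = (of_nat q - 1) / 2 + v'" "P' = (of_nat p - 1) / 2 + u'"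
        and f: "f \<in> smooth_fns" for u' v' P' Q' f
      using product[OF sum_eq[OF that(1-3)] f] product[OF PQ f] by (simp only:)
  qed
qed

end
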